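(* Let $e\ge 3$ be an odd integer, $q=2^e$, and let $\mathcal{V}^4_\varepsilon\subset\mathrm{PG}(4,q^2)$ be the hypersurface defined in the context (with $r=4$). Then its cutting gaps satisfy $$\tau_1(\mathcal{V}^4_\varepsilon)=2,\qquad \tau_2(\mathcal{V}^4_\varepsilon)=2,\qquad \tau_3(\mathcal{V}^4_\varepsilon)=0.$$
   Context: Let $e\ge 3$ be odd, $q=2^e$, $r\ge 2$. Points of $\mathrm{PG}(r,q^2)$ (projective space of projective dimension $r$ over $\mathbb{F}_{q^2}$) have homogeneous coordinates $(X_0,\dots,X_r)$; $\Pi_\infty$ is the hyperplane $X_0=0$, and affine coordinates on the complement $\mathrm{AG}(r,q^2)$ are $x_i=X_i/X_0$. For an exponent involving $\sigma$, $\sigma$ stands for $2^{(e+1)/2}$, i.e. $x^{\sigma}=x^{2^{(e+1)/2}}$ and $x^{\sigma+2}=x^{2^{(e+1)/2}+2}$. Fix $\varepsilon\in\mathbb{F}_{q^2}\setminus\mathbb{F}_q$ such that $\varepsilon^2+\varepsilon+\delta=0$ for some $\delta\in\mathbb{F}_q\setminus\{1\}$ with absolute trace $\mathrm{Tr}_{q/2}(\delta)=\sum_{i=0}^{e-1}\delta^{2^i}=1$. Put $$\Gamma_{\varepsilon}(x)=[x+(x^q+x)\varepsilon]^{\sigma+2}+(x^q+x)^{\sigma}+(x^{2q}+x^2)\varepsilon+x^{q+1}+x^2.$$ $\mathcal{V}^r_\varepsilon$ is the projective hypersurface of $\mathrm{PG}(r,q^2)$ with affine equation $x_r^q+x_r=\Gamma_{\varepsilon}(x_1)+\dots+\Gamma_{\varepsilon}(x_{r-1})$,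 i.e. the zero locus of the homogenization (with respect to $X_0$) of the corresponding polynomial; it is identified with its set of $\mathbb{F}_{q^2}$-rational points. Dimensions are projective, with the convention $\dim(\emptyset)=-1$. For a non-empty set $\Omega$ of points of $\mathrm{PG}(r,\mathbb{K})$ and $0\le k\le r$, the $k$-th cutting gap of $\Omega$ is $$\tau_k(\Omega)=k-\min\{\dim\langle\Pi\cap\Omega\rangle : \Pi \text{ a subspace of } \mathrm{PG}(r,\mathbb{K}),\ \dim\Pi=k\}.$$ *)

theory Defs
  imports "HOL-Analysis.Cartesian_Space" "HOL-Library.Poly_Mapping" "HOL-Library.Numeral_Type"
begin

section \<open>Projective geometry\<close>

text \<open>
  A subspace of \<open>PG(r,K)\<close> is represented by a linear subspace of \<open>K\<^sup>r\<^sup>+\<^sup>1\<close>, a point by a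
  one-dimensional one. The zero subspace is the empty projective subspace, of dimension \<open>-1\<close>.
\<close>

definition proj_dim :: "('a::field ^ 'n::finite) set \<Rightarrow> int"
  where "proj_dim U = int (vec.dim U) - 1"

definition proj_points :: "('a::field ^ 'n::finite) set set"
  where "proj_points = {P. vec.subspace P \<and> proj_dim P = 0}"

definition proj_span :: "('a::field ^ 'n::finite) set set \<Rightarrow> ('a ^ 'n) set"
  where "proj_span \<Omega> = vec.span (\<Union>\<Omega>)"

text \<open>
  The minimum is over a nonempty finite set of integers whenever \<open>k \<le> r\<close>, that is, whenever
  \<open>k < CARD('n)\<close>.
\<close>

definition cutting_gap :: "nat \<Rightarrow> ('a::field ^ 'n::finite) set set \<Rightarrow> int"
  where "cutting_gap k \<Omega> =
    int k - Min {proj_dim (proj_span {P \<in> \<Omega>. P \<subseteq> U}) | U. vec.subspace U \<and> proj_dim U = int k}"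


section \<open>Polynomials and hypersurfaces\<close>

type_synonym ('n, 'a) mpoly = "('n \<Rightarrow>\<^sub>0 nat) \<Rightarrow>\<^sub>0 'a"

definition Const :: "'a::comm_ring_1 \<Rightarrow> ('n, 'a) mpoly"
  where "Const c = Poly_Mapping.single 0 c"

definition Var :: "'n \<Rightarrow> ('n, 'a::comm_ring_1) mpoly"
  where "Var i = Poly_Mapping.single (Poly_Mapping.single i 1) 1"

definition eval_poly :: "('n::finite, 'a::comm_ring_1) mpoly \<Rightarrow> 'a ^ 'n \<Rightarrow> 'a"
  where "eval_poly f v =
    (\<Sum>m\<in>Poly_Mapping.keys f. Poly_Mapping.lookup f m * (\<Prod>i\<in>UNIV. v $ i ^ Poly_Mapping.lookup m i))"

definition monom_degree :: "('n::finite \<Rightarrow>\<^sub>0 nat) \<Rightarrow> nat"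
  where "monom_degree m = (\<Sum>i\<in>UNIV. Poly_Mapping.lookup m i)"

definition total_degree :: "('n::finite, 'a::comm_ring_1) mpoly \<Rightarrow> nat"
  where "total_degree f = Max (insert 0 (monom_degree ` Poly_Mapping.keys f))"

text \<open>Homogenization with respect to \<open>z\<close>, meant for polynomials in which \<open>z\<close> does not occur.\<close>

definition homogenization :: "'n \<Rightarrow> ('n::finite, 'a::comm_ring_1) mpoly \<Rightarrow> ('n, 'a) mpoly"
  where "homogenization z f =
    (\<Sum>m\<in>Poly_Mapping.keys f.
       Poly_Mapping.single (m + Poly_Mapping.single z (total_degree f - monom_degree m))
         (Poly_Mapping.lookup f m))"

definition proj_zeros :: "('n::finite, 'a::field) mpoly \<Rightarrow> ('a ^ 'n) set set"
  where "proj_zeros f = {P \<in> proj_points. \<forall>v\<in>P. eval_poly f v = 0}"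


section \<open>The hypersurface\<close>

text \<open>
  Inside a field with \<open>q\<^sup>2\<close> elements, the subfield with \<open>q\<close> elements is the fixed field of
  \<open>x \<mapsto> x\<^sup>q\<close>.
\<close>

definition subfield_of_order :: "nat \<Rightarrow> 'a::field set"
  where "subfield_of_order q = {x. x ^ q = x}"

definition abs_trace :: "nat \<Rightarrow> 'a::field \<Rightarrow> 'a"
  where "abs_trace e d = (\<Sum>i<e. d ^ (2 ^ i))"

definition admissible :: "nat \<Rightarrow> 'a::field \<Rightarrow> bool"
  where "admissible e \<epsilon> \<longleftrightarrow>
    \<epsilon> \<notin> subfield_of_order (2 ^ e) \<and>
    (\<exists>\<delta> \<in> subfield_of_order (2 ^ e) - {1}. abs_trace e \<delta> = 1 \<and> \<epsilon>\<^sup>2 + \<epsilon> + \<delta> = 0)"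

text \<open>
  \<open>Gam\<close> is stated over an arbitrary commutative ring, as it is used with polynomials for \<open>x\<close> and
  the constant polynomial \<open>\<epsilon>\<close> for \<open>c\<close>.
\<close>

definition Gam :: "nat \<Rightarrow> 'b::comm_ring_1 \<Rightarrow> 'b \<Rightarrow> 'b"
  where "Gam e c x = (let q = 2 ^ e; \<sigma> = 2 ^ ((e + 1) div 2) in
    (x + (x ^ q + x) * c) ^ (\<sigma> + 2) + (x ^ q + x) ^ \<sigma> + (x ^ (2 * q) + x\<^sup>2) * c + x ^ (q + 1) + x\<^sup>2)"

text \<open>
  The homogeneous coordinates \<open>X\<^sub>0, \<dots>, X\<^sub>4\<close> are indexed by the five elements of the type \<open>5\<close>.
\<close>

definition affine_poly4 :: "nat \<Rightarrow> 'a::field \<Rightarrow> (5, 'a) mpoly"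
  where "affine_poly4 e \<epsilon> = Var 4 ^ (2 ^ e) + Var 4 - (\<Sum>i\<in>{1, 2, 3}. Gam e (Const \<epsilon>) (Var i))"

definition V4 :: "nat \<Rightarrow> 'a::field \<Rightarrow> ('a ^ 5) set set"
  where "V4 e \<epsilon> = proj_zeros (homogenization 0 (affine_poly4 e \<epsilon>))"

end

(*
  Write x = a + b eps with a, b in F_q. Then Gam(x) = a^(sigma+2) + a b + b^sigma is the function
  whose graph over F_q is the affine Tits ovoid, and x^q + x = b. At infinity the hypersurface is the
  cone with vertex (0,0,0,0,1) over the plane curve C: x^(sigma+2) + y^(sigma+2) + z^(sigma+2) = 0.

  Lines: in the direction (1, a, a+1) with a in F_q \ F_2 the sum of the three values of Gam collapses
  to (a^sigma + a^2) t^(sigma+2) for a single F_q-coordinate t. With a suitable linear term the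
  resulting function of t is not injective on F_q, so it omits a value, which gives a disjoint line.
  Planes: a plane contains a line of the hyperplane X_1 = X_2, where the hypersurface is a cone over a
  plane curve met by every line; and the plane at infinity spanned by the vertex and a line missing C
  contains only the vertex. Solids: the points at infinity together with one affine point span.
*)

theory Submission
  imports Defs "HOL-Computational_Algebra.Polynomial"
begin

section \<open>Evaluation of homogenizations\<close>

text \<open>Coefficient map and values stay general because substitution is used twice: with values
  in the ring itself, which is evaluation, and with values in \<open>'a poly\<close>, which records
  degrees.\<close>

locale subst_hom =
  fixes h :: "'a::comm_ring_1 \<Rightarrow> 'b::comm_ring_1" and w :: "'n::finite \<Rightarrow> 'b"
  assumes h_add: "h (x + y) = h x + h y"
    and h_mult: "h (x * y) = h x * h y"
    and h_one: "h 1 = 1"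
begin

lemma h_zero: "h 0 = 0"
  using h_add[of 0 0] by simp

definition subst :: "('n, 'a) mpoly \<Rightarrow> 'b" where
  "subst f = (\<Sum>m\<in>Poly_Mapping.keys f. h (Poly_Mapping.lookup f m) * (\<Prod>i\<in>UNIV. w i ^ Poly_Mapping.lookup m i))"

lemma subst_superset:
  assumes "finite A" "Poly_Mapping.keys f \<subseteq> A"
  shows "subst f = (\<Sum>m\<in>A. h (Poly_Mapping.lookup f m) * (\<Prod>i\<in>UNIV. w i ^ Poly_Mapping.lookup m i))"
  unfolding subst_def using assms
  by (intro sum.mono_neutral_left) (auto simp: in_keys_iff h_zero)

lemma subst_add: "subst (f + g) = subst f + subst g"
proof -
  let ?A = "Poly_Mapping.keys f \<union> Poly_Mapping.keys g"
  have "Poly_Mapping.keys (f + g) \<subseteq> ?A" by (rule Poly_Mapping.keys_add)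
  then show ?thesis
    by (simp add: subst_superset[of ?A] lookup_add h_add algebra_simps sum.distrib)
qed

lemma subst_zero [simp]: "subst 0 = 0"
  by (simp add: subst_def)

lemma subst_uminus: "subst (- f) = - subst f"
  using subst_add[of f "- f"] by (simp add: eq_neg_iff_add_eq_0 add.commute)

lemma subst_diff: "subst (f - g) = subst f - subst g"
  using subst_add[of f "- g"] by (simp add: subst_uminus)

lemma subst_sum: "subst (\<Sum>i\<in>I. f i) = (\<Sum>i\<in>I. subst (f i))"
  by (induction I rule: infinite_finite_induct) (auto simp: subst_add)

lemma subst_single:
  "subst (Poly_Mapping.single m c) = h c * (\<Prod>i\<in>UNIV. w i ^ Poly_Mapping.lookup m i)"
  by (subst subst_superset[of "{m}"]) auto

lemma subst_mult: "subst (f * g) = subst f * subst g"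
proof -
  have decomp: "f = (\<Sum>m\<in>Poly_Mapping.keys f. Poly_Mapping.single m (Poly_Mapping.lookup f m))"
    for f :: "('n, 'a) mpoly"
    by (rule poly_mapping_eqI)
      (auto simp: lookup_sum lookup_single when_def sum.delta' in_keys_iff)
  have single: "subst (Poly_Mapping.single m c * Poly_Mapping.single m' c') =
      subst (Poly_Mapping.single m c) * subst (Poly_Mapping.single m' c')" for m m' c c'
    by (simp add: mult_single subst_single h_mult lookup_add power_add prod.distrib algebra_simps)
  define F where "F p m = Poly_Mapping.single m (Poly_Mapping.lookup p m)" for p :: "('n, 'a) mpoly" and m
  have F: "p = sum (F p) (Poly_Mapping.keys p)" for p
    unfolding F_def by (rule decomp)
  have "subst (sum (F f) A * sum (F g) B) = subst (sum (F f) A) * subst (sum (F g) B)" for A B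
    by (simp add: sum_product subst_sum F_def single)
  then show ?thesis
    using F by metis
qed

lemma subst_one [simp]: "subst 1 = 1"
  using subst_single[of 0 1] by (simp add: h_one)

lemma subst_power: "subst (f ^ n) = subst f ^ n"
  by (induction n) (auto simp: subst_mult)

lemma subst_Const [simp]: "subst (Const c) = h c"
  by (simp add: Const_def subst_single)

lemma subst_Var [simp]: "subst (Var i) = w i"
proof -
  have "(\<Prod>j\<in>UNIV. w j ^ Poly_Mapping.lookup (Poly_Mapping.single i 1) j) = (\<Prod>j\<in>UNIV. if j = i then w j else 1)"
    by (intro prod.cong) (auto simp: lookup_single when_def)
  then show ?thesis
    by (simp add: Var_def subst_single h_one)
qed

lemma subst_Gam: "subst (Gam e c x) = Gam e (subst c) (subst x)"
  by (simp add: Gam_def Let_def subst_add subst_mult subst_power)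

end

interpretation eval_hom: subst_hom "\<lambda>c. c" "\<lambda>i. v $ i"
  rewrites "subst_hom.subst (\<lambda>c. c) (\<lambda>i. v $ i) f = eval_poly f v"
    for v :: "'a::comm_ring_1 ^ 'n::finite"
proof -
  show "subst_hom (\<lambda>c::'a. c)" by unfold_locales auto
  then interpret subst_hom "\<lambda>c. c" "\<lambda>i. v $ i" .
  show "subst f = eval_poly f v" by (simp add: subst_def eval_poly_def)
qed

text \<open>
  Substituting \<open>v\<^sub>i T\<close> for the \<open>i\<close>-th variable separates the homogeneous components: the
  coefficient of \<open>T\<^sup>d\<close> is the value at \<open>v\<close> of the component of degree \<open>d\<close>.
\<close>

interpretation grade_hom: subst_hom "\<lambda>c. [:c:]" "\<lambda>i. [:0, v $ i:]"
  for v :: "'a::comm_ring_1 ^ 'n::finite"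
  by unfold_locales (auto simp: one_pCons)

abbreviation graded_eval :: "'a::comm_ring_1 ^ 'n::finite \<Rightarrow> ('n, 'a) mpoly \<Rightarrow> 'a poly" where
  "graded_eval v \<equiv> subst_hom.subst (\<lambda>c. [:c:]) (\<lambda>i. [:0, v $ i:])"

lemma coeff_graded_eval:
  "coeff (graded_eval v f) d = (\<Sum>m\<in>Poly_Mapping.keys f.
     if monom_degree m = d then Poly_Mapping.lookup f m * (\<Prod>i\<in>UNIV. v $ i ^ Poly_Mapping.lookup m i) else 0)"
proof -
  have prod: "(\<Prod>i\<in>I. [:0, v $ i:] ^ Poly_Mapping.lookup m i) =
    monom (\<Prod>i\<in>I. v $ i ^ Poly_Mapping.lookup m i) (\<Sum>i\<in>I. Poly_Mapping.lookup m i)" for I :: "'b set" and m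
  proof (induction I rule: infinite_finite_induct)
    case (insert i I)
    have "[:0, v $ i:] = monom (v $ i) 1" by (simp add: monom_altdef)
    with insert show ?case by (simp add: monom_power mult_monom)
  qed (auto simp: monom_0 one_pCons)
  show ?thesis
    by (simp add: grade_hom.subst_def coeff_sum prod monom_degree_def smult_monom if_distrib cong: if_cong)
qed

text \<open>Unlike \<open>total_degree\<close>, an upper bound passes through sums in which leading
  terms may cancel.\<close>

definition degree_le :: "('n::finite, 'a::comm_ring_1) mpoly \<Rightarrow> nat \<Rightarrow> bool" where
  "degree_le f d \<longleftrightarrow> (\<forall>m\<in>Poly_Mapping.keys f. monom_degree m \<le> d)"

lemma monom_degree_add: "monom_degree (m + m') = monom_degree m + monom_degree m'"
  by (simp add: monom_degree_def lookup_add sum.distrib)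

lemma monom_degree_single: "monom_degree (Poly_Mapping.single i n) = n"
  by (simp add: monom_degree_def lookup_single when_def)

lemma degree_le_mono: "degree_le f d \<Longrightarrow> d \<le> d' \<Longrightarrow> degree_le f d'"
  by (auto simp: degree_le_def)

lemma degree_le_add: "degree_le f d \<Longrightarrow> degree_le g d \<Longrightarrow> degree_le (f + g) d"
  using Poly_Mapping.keys_add[of f g] by (auto simp: degree_le_def)

lemma degree_le_diff: "degree_le f d \<Longrightarrow> degree_le g d \<Longrightarrow> degree_le (f - g) d"
  using Poly_Mapping.keys_diff[of f g] by (auto simp: degree_le_def)

lemma degree_le_mult: "degree_le f d \<Longrightarrow> degree_le g d' \<Longrightarrow> degree_le (f * g) (d + d')"
  unfolding degree_le_def
proof
  fix m
  assume f: "\<forall>m\<in>Poly_Mapping.keys f. monom_degree m \<le> d"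
    and g: "\<forall>m\<in>Poly_Mapping.keys g. monom_degree m \<le> d'"
    and "m \<in> Poly_Mapping.keys (f * g)"
  then obtain a b where "a \<in> Poly_Mapping.keys f" "b \<in> Poly_Mapping.keys g" "m = a + b"
    using Poly_Mapping.keys_mult[of f g] by blast
  with f g show "monom_degree m \<le> d + d'"
    by (simp add: monom_degree_add add_mono)
qed

lemma degree_le_Const: "degree_le (Const c) 0"
  by (auto simp: degree_le_def Const_def monom_degree_def)

lemma degree_le_Var: "degree_le (Var i) 1"
  by (auto simp: degree_le_def Var_def monom_degree_single)

lemma degree_le_power: "degree_le f d \<Longrightarrow> degree_le (f ^ n) (n * d)"
proof (induction n)
  case 0
  then show ?case using degree_le_Const[of 1] by (simp add: Const_def)
qed (auto intro: degree_le_mult)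

lemma degree_le_sum: "(\<And>i. i \<in> I \<Longrightarrow> degree_le (f i) d) \<Longrightarrow> degree_le (\<Sum>i\<in>I. f i) d"
proof (induction I rule: infinite_finite_induct)
  case (insert i I)
  then show ?case by (simp add: degree_le_add)
qed (auto simp: degree_le_def)

lemma monom_degree_le_total_degree:
  "m \<in> Poly_Mapping.keys f \<Longrightarrow> monom_degree m \<le> total_degree f"
  by (simp add: total_degree_def)

text \<open>A nonzero coefficient at one vector already forces a monomial of degree \<open>d\<close>
  to occur, so the bound is attained.\<close>

lemma total_degree_eqI:
  assumes "degree_le f d" "coeff (graded_eval v f) d \<noteq> 0"
  shows "total_degree f = d"
proof -
  obtain m where m: "m \<in> Poly_Mapping.keys f" "monom_degree m = d"
  proof -
    have "\<not> (\<forall>m\<in>Poly_Mapping.keys f. monom_degree m \<noteq> d)"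
    proof
      assume "\<forall>m\<in>Poly_Mapping.keys f. monom_degree m \<noteq> d"
      then have "coeff (graded_eval v f) d = 0" by (simp add: coeff_graded_eval)
      with assms(2) show False by simp
    qed
    with that show ?thesis by blast
  qed
  show ?thesis
    unfolding total_degree_def
    using assms(1) m by (intro Max_eqI) (auto simp: degree_le_def)
qed

section \<open>Homogenizations at infinity and at affine vectors; leading coefficients\<close>

lemma eval_homogenization:
  "eval_poly (homogenization z f) v = (\<Sum>m\<in>Poly_Mapping.keys f. Poly_Mapping.lookup f m *
     (\<Prod>i\<in>UNIV. v $ i ^ Poly_Mapping.lookup m i) * v $ z ^ (total_degree f - monom_degree m))"
proof -
  have "(\<Prod>i\<in>UNIV. v $ i ^ (Poly_Mapping.lookup m i + Poly_Mapping.lookup (Poly_Mapping.single z n) i)) =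
    (\<Prod>i\<in>UNIV. v $ i ^ Poly_Mapping.lookup m i) * v $ z ^ n" for m n
  proof -
    have "(\<Prod>i\<in>UNIV. v $ i ^ Poly_Mapping.lookup (Poly_Mapping.single z n) i) =
      (\<Prod>i\<in>UNIV. if i = z then v $ i ^ n else 1)"
      by (intro prod.cong) (auto simp: lookup_single when_def)
    then show ?thesis by (simp add: power_add prod.distrib)
  qed
  then show ?thesis
    by (simp add: homogenization_def eval_hom.subst_sum eval_hom.subst_single lookup_add mult.assoc)
qed

text \<open>The extra factor is a power of \<open>v $ z = 0\<close>: it kills every monomial except
  those of top degree, where the exponent is 0 and the factor is 1.\<close>

lemma eval_homogenization_infinity:
  assumes "v $ z = 0"
  shows "eval_poly (homogenization z f) v = coeff (graded_eval v f) (total_degree f)"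
  unfolding eval_homogenization coeff_graded_eval using assms monom_degree_le_total_degree[of _ f]
  by (intro sum.cong) (auto simp: power_0_left dest: le_antisym)

lemma eval_homogenization_affine:
  fixes v :: "'a::field ^ 'n::finite"
  assumes "v $ z \<noteq> 0"
  shows "eval_poly (homogenization z f) v =
    (v $ z) ^ total_degree f * eval_poly f (\<chi> i. v $ i / v $ z)"
proof -
  have "(\<Prod>i\<in>UNIV. (v $ i / v $ z) ^ Poly_Mapping.lookup m i) =
     (\<Prod>i\<in>UNIV. v $ i ^ Poly_Mapping.lookup m i) / v $ z ^ monom_degree m" for m
    by (simp add: power_divide prod_dividef power_sum monom_degree_def)
  then show ?thesis
    unfolding eval_homogenization eval_poly_def[of f] sum_distrib_left
    using assms monom_degree_le_total_degree[of _ f]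
    by (intro sum.cong) (auto simp: power_diff)
qed

text \<open>In the convolution an index below \<open>a\<close> puts the other index above
  \<open>b\<close>, and an index above \<open>a\<close> exceeds the degree of
  \<open>p\<close>.\<close>

lemma coeff_mult_top:
  fixes p r :: "'a::comm_ring_1 poly"
  assumes "degree p \<le> a" "degree r \<le> b"
  shows "coeff (p * r) (a + b) = coeff p a * coeff r b"
proof -
  have "coeff (p * r) (a + b) = (\<Sum>i\<le>a + b. if i = a then coeff p a * coeff r b else 0)"
    unfolding coeff_mult
  proof (intro sum.cong refl)
    fix i assume "i \<in> {..a + b}"
    show "coeff p i * coeff r (a + b - i) = (if i = a then coeff p a * coeff r b else 0)"
    proof (cases "i < a")
      case True
      then have "coeff r (a + b - i) = 0" using assms by (intro coeff_eq_0) auto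
      with True show ?thesis by simp
    next
      case False
      then show ?thesis using assms by (cases "i = a") (auto simp: coeff_eq_0)
    qed
  qed
  then show ?thesis by simp
qed

lemma coeff_power_top:
  fixes p :: "'a::comm_ring_1 poly"
  assumes "degree p \<le> a"
  shows "coeff (p ^ n) (n * a) = coeff p a ^ n"
proof (induction n)
  case (Suc n)
  have "degree (p ^ n) \<le> n * a"
    using degree_power_le[of p n] assms by (metis le_trans mult.commute mult_le_mono1)
  with Suc assms show ?case by (simp add: coeff_mult_top)
qed simp

section \<open>Linear algebra\<close>

lemma dim_kernel_functional:
  fixes U :: "('a::field ^ 'n::finite) set"
  assumes U: "vec.subspace U"
    and add: "\<And>x y. l (x + y) = l x + l y" and scale: "\<And>c x. l (c *s x) = c * l x"
    and u: "u \<in> U" "l u \<noteq> (0::'a)"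
  shows "vec.dim U = vec.dim {v \<in> U. l v = 0} + 1"
proof -
  let ?W = "{v \<in> U. l v = 0}"
  have W: "vec.subspace ?W"
    using vec.subspace_0[OF U] vec.subspace_add[OF U] vec.subspace_scale[OF U] scale[of 0 0]
    by (intro vec.subspaceI) (auto simp: add scale)
  have "u \<notin> vec.span ?W"
    using u W by (simp add: vec.span_eq_iff[THEN iffD2])
  then have dim: "vec.dim (insert u ?W) = vec.dim ?W + 1"
    by (simp add: vec.dim_insert)
  have "U \<subseteq> vec.span (insert u ?W)"
  proof
    fix v assume v: "v \<in> U"
    let ?c = "l v / l u"
    have "l (v - ?c *s u) = 0"
      using add[of "v - ?c *s u" "?c *s u"] u by (simp add: scale)
    then have "v - ?c *s u \<in> ?W"
      using U u v by (simp add: vec.subspace_diff vec.subspace_scale)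
    then show "v \<in> vec.span (insert u ?W)"
      unfolding vec.span_insert by (auto intro: vec.span_base)
  qed
  then have "vec.dim U \<le> vec.dim (insert u ?W)" by (rule vec.dim_mono)
  moreover have "vec.dim (insert u ?W) \<le> vec.dim U"
    using u by (intro vec.dim_subset) auto
  ultimately show ?thesis using dim by simp
qed

lemma dim_kernel_functional_ge:
  fixes U :: "('a::field ^ 'n::finite) set"
  assumes "vec.subspace U"
    and "\<And>x y. l (x + y) = l x + l y" and "\<And>c x. l (c *s x) = c * l x"
  shows "vec.dim U \<le> vec.dim {v \<in> U. l v = (0::'a)} + 1"
proof (cases "\<exists>u\<in>U. l u \<noteq> 0")
  case True
  then show ?thesis using dim_kernel_functional[OF assms] by fastforce
next
  case False
  then have "{v \<in> U. l v = 0} = U" by auto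
  then show ?thesis by simp
qed

lemma forall_5: "(\<forall>i::5. P i) \<longleftrightarrow> P 0 \<and> P 1 \<and> P 2 \<and> P 3 \<and> P 4"
proof -
  have UNIV_5: "(UNIV :: 5 set) = {0, 1, 2, 3, 4}"
    by (rule card_subset_eq[symmetric]) auto
  have "(\<forall>i::5. P i) \<longleftrightarrow> (\<forall>i\<in>UNIV. P i)" by simp
  then show ?thesis unfolding UNIV_5 by simp
qed

lemma vec_eq_iff_5: "v = w \<longleftrightarrow>
  v $ 0 = w $ 0 \<and> v $ 1 = w $ 1 \<and> v $ 2 = w $ 2 \<and> v $ 3 = w $ 3 \<and> v $ (4::5) = w $ 4"
  by (simp add: vec_eq_iff forall_5)

definition vec5 :: "'a \<Rightarrow> 'a \<Rightarrow> 'a \<Rightarrow> 'a \<Rightarrow> 'a \<Rightarrow> 'a ^ 5" where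
  "vec5 a b c d f = (\<chi> i. if i = 0 then a else if i = 1 then b else if i = 2 then c else if i = 3 then d else f)"

lemma vec5_nth [simp]:
  "vec5 a b c d f $ 0 = a" "vec5 a b c d f $ 1 = b" "vec5 a b c d f $ 2 = c"
  "vec5 a b c d f $ 3 = d" "vec5 a b c d f $ 4 = f"
  by (simp_all add: vec5_def)

section \<open>Finite fields of even order\<close>

text \<open>Translation by 1 permutes the ring, so adding the cardinality does not change the sum of
  all elements. This yields characteristic 2 below.\<close>

lemma of_nat_card_eq_zero: "of_nat CARD('a::{comm_ring_1, finite}) = (0::'a)"
proof -
  have "(\<Sum>x\<in>UNIV. x :: 'a) = (\<Sum>x\<in>UNIV. x + 1)"
    by (rule sum.reindex_bij_witness[of _ "\<lambda>x. x + 1" "\<lambda>x. x - 1"]) auto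
  then show ?thesis by (simp add: sum.distrib)
qed

lemma power_card_eq_self:
  fixes x :: "'a::{field, finite}"
  shows "x ^ CARD('a) = x"
proof (cases "x = 0")
  case False
  have "(\<Prod>y\<in>UNIV - {0}. y) = (\<Prod>y\<in>UNIV - {0}. x * y)"
    by (rule prod.reindex_bij_witness[of _ "\<lambda>y. x * y" "\<lambda>y. y / x"]) (use False in auto)
  then have "x ^ (CARD('a) - 1) = 1"
    by (simp add: prod.distrib card_Diff_singleton)
  moreover have "CARD('a) = Suc (CARD('a) - 1)"
    using zero_less_card_finite[where 'a='a] by linarith
  ultimately show ?thesis
    by (metis mult.right_neutral power_Suc)
qed (simp add: zero_power)

locale bt_hypersurface =
  fixes e :: nat and \<epsilon> :: "'a::{field, finite}"
  assumes e_ge_3: "e \<ge> 3" and odd_e: "odd e"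
    and card: "CARD('a) = (2 ^ e)\<^sup>2"
    and admissible: "admissible e \<epsilon>"
begin

definition q :: nat where "q = 2 ^ e"
definition \<sigma> :: nat where "\<sigma> = 2 ^ ((e + 1) div 2)"
definition K :: "'a set" where "K = {x. x ^ q = x}"
definition tr :: "'a \<Rightarrow> 'a" where "tr x = x ^ q + x"

section \<open>Arithmetic in characteristic 2\<close>

lemma two_eq_zero [simp]: "(2::'a) = 0"
  using of_nat_card_eq_zero[where 'a='a] by (simp add: card)

lemma add_self [simp]: "x + x = (0::'a)"
  using two_eq_zero by (metis mult_2 mult_zero_left)

lemma add_self_left [simp]: "x + (x + y) = (y::'a)"
  by (simp flip: add.assoc)

lemma uminus_eq: "- x = (x::'a)"
  by (rule minus_unique) simp

lemma diff_eq_add: "x - y = x + (y::'a)"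
  using uminus_eq[of y] by (metis diff_conv_add_uminus)

lemma add_eq_0_iff: "x + y = 0 \<longleftrightarrow> x = (y::'a)"
  using uminus_eq[of y] by (metis eq_neg_iff_add_eq_0)

lemma add_power2: "(x + y :: 'a)\<^sup>2 = x\<^sup>2 + y\<^sup>2"
  by (simp add: power2_sum two_eq_zero)

lemma add_power_2pow: "(x + y :: 'a) ^ 2 ^ n = x ^ 2 ^ n + y ^ 2 ^ n"
  by (induction n) (simp_all add: power_mult mult.commute[of 2] add_power2)

lemma frobenius: "(x + y :: 'a) ^ q = x ^ q + y ^ q" "(x + y :: 'a) ^ \<sigma> = x ^ \<sigma> + y ^ \<sigma>"
  by (simp_all add: q_def \<sigma>_def add_power_2pow)

lemma power_2pow_inject: "(x::'a) ^ 2 ^ n = y ^ 2 ^ n \<longleftrightarrow> x = y"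
proof -
  have "x ^ 2 ^ n = y ^ 2 ^ n \<longleftrightarrow> (x + y) ^ 2 ^ n = 0"
    by (simp add: add_power_2pow add_eq_0_iff)
  then show ?thesis by (simp add: add_eq_0_iff)
qed

lemma q_ge_8: "q \<ge> 8"
  using power_increasing[OF e_ge_3, of "2::nat"] by (simp add: q_def)

text \<open>Hence applying x^\<sigma> twice is squaring on \<open>K\<close>, the defining property
  of a Tits automorphism.\<close>

lemma \<sigma>_squared: "\<sigma> * \<sigma> = 2 * q"
proof -
  have "(e + 1) div 2 + (e + 1) div 2 = Suc e" using odd_e by presburger
  then show ?thesis by (simp add: \<sigma>_def q_def flip: power_add)
qed

lemma \<sigma>_pos: "\<sigma> > 0" by (simp add: \<sigma>_def)

lemma power_q_q: "(x ^ q) ^ q = (x::'a)"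
  using power_card_eq_self[of x] card by (simp add: q_def power2_eq_square power_mult)

section \<open>The subfield F_q, the trace, and coordinates over F_q\<close>

lemma K_iff: "x \<in> K \<longleftrightarrow> x ^ q = x" by (simp add: K_def)

lemma K_closed:
  assumes "x \<in> K" "y \<in> K"
  shows "x + y \<in> K" "x * y \<in> K" "x ^ n \<in> K" "x / y \<in> K"
  using assms by (simp_all add: K_iff frobenius power_mult_distrib power_divide)
    (metis mult.commute power_mult)

lemma K_01 [simp]: "0 \<in> K" "1 \<in> K"
  using q_ge_8 by (simp_all add: K_iff)

text \<open>As \<delta> lies in F_q, \<epsilon>^q is again a root of T^2 + T + \<delta>, whose roots
  are \<epsilon> and \<epsilon> + 1; it is not \<epsilon>, which lies outside F_q.\<close>

lemma \<epsilon>_conj: "\<epsilon> ^ q = \<epsilon> + 1"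
proof -
  obtain \<delta> where \<epsilon>: "\<epsilon> ^ q \<noteq> \<epsilon>" and \<delta>: "\<delta> ^ q = \<delta>" and root: "\<epsilon>\<^sup>2 + \<epsilon> + \<delta> = 0"
    using admissible by (auto simp: admissible_def subfield_of_order_def q_def)
  have "(\<epsilon> ^ q)\<^sup>2 + \<epsilon> ^ q + \<delta> = (\<epsilon>\<^sup>2 + \<epsilon> + \<delta>) ^ q"
    using \<delta> by (simp add: frobenius mult.commute flip: power_mult)
  also have "\<dots> = 0" using root q_ge_8 by simp
  finally have "(\<epsilon> ^ q)\<^sup>2 + \<epsilon> ^ q + \<delta> = 0" .
  with root have "(\<epsilon> ^ q)\<^sup>2 + \<epsilon> ^ q = \<epsilon>\<^sup>2 + \<epsilon>"
    by (metis add_right_cancel)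
  then have "(\<epsilon> ^ q + \<epsilon>) * (\<epsilon> ^ q + \<epsilon> + 1) = 0"
    by (simp add: algebra_simps power2_eq_square)
  with \<epsilon> have "\<epsilon> ^ q + \<epsilon> + 1 = 0" by (simp add: add_eq_0_iff)
  then show ?thesis by (simp add: add_eq_0_iff add.assoc)
qed

lemma tr_K [simp]: "tr x \<in> K"
  by (simp add: tr_def K_iff frobenius power_q_q add.commute)

lemma tr_add: "tr (x + y) = tr x + tr y"
  by (simp add: tr_def frobenius algebra_simps)

lemma tr_of_K: "a \<in> K \<Longrightarrow> tr a = 0"
  by (simp add: tr_def K_iff)

lemma tr_mult_K: "a \<in> K \<Longrightarrow> tr (a * x) = a * tr x"
  by (simp add: tr_def K_iff power_mult_distrib algebra_simps)

lemma tr_\<epsilon> [simp]: "tr \<epsilon> = 1"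
  using add_self_left[of \<epsilon> 1] by (simp add: tr_def \<epsilon>_conj add.commute)

text \<open>Since \<open>tr \<epsilon> = 1\<close>, the second coordinate has to be
  \<open>tr x\<close>; what remains is fixed by the q-th power.\<close>

lemma coordinates:
  obtains a b where "a \<in> K" "b \<in> K" "x = a + b * \<epsilon>"
proof
  show "x + tr x * \<epsilon> \<in> K"
    using tr_K[of x] unfolding K_iff
    by (simp add: frobenius power_mult_distrib \<epsilon>_conj) (simp add: tr_def algebra_simps)
  show "tr x \<in> K" by simp
  show "x = x + tr x * \<epsilon> + tr x * \<epsilon>" by (simp add: add.assoc)
qed

lemma tr_prod_coordinates:
  assumes "a \<in> K" "b \<in> K" "c \<in> K" "d \<in> K"
  shows "tr ((a + b * \<epsilon>) * (c + d * \<epsilon>)) = a * d + b * c + b * d"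
proof -
  have eps2: "tr (\<epsilon> * \<epsilon>) = 1"
    unfolding tr_def power_mult_distrib \<epsilon>_conj by (simp add: algebra_simps)
  have "(a + b * \<epsilon>) * (c + d * \<epsilon>) = a * c + ((a * d + b * c) * \<epsilon> + (b * d) * (\<epsilon> * \<epsilon>))"
    by (simp add: algebra_simps)
  then show ?thesis
    using assms eps2 by (simp add: tr_add tr_of_K tr_mult_K K_closed)
qed

text \<open>The bracket in \<open>Gam\<close> is the coordinate \<open>a\<close>, and x^q + x is
  \<open>b\<close>. The last three terms of \<open>Gam\<close> add up to b^2 \<epsilon> + b x = a
  b.\<close>

lemma Gam_coordinates:
  assumes "a \<in> K" "b \<in> K"
  shows "Gam e \<epsilon> (a + b * \<epsilon>) = a ^ (\<sigma> + 2) + a * b + b ^ \<sigma>"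
proof -
  let ?x = "a + b * \<epsilon>"
  have conj: "?x ^ q = a + b * \<epsilon> + b"
    using assms by (simp add: frobenius power_mult_distrib \<epsilon>_conj K_iff algebra_simps)
  have t: "?x ^ q + ?x = b" unfolding conj by (simp add: add.commute)
  have p1: "?x ^ (2 * q) = (?x ^ q)\<^sup>2" by (simp add: mult.commute[of 2] power_mult)
  have p2: "?x ^ (q + 1) = ?x ^ q * ?x" by simp
  have 1: "?x + b * \<epsilon> = a" by (simp add: add.assoc)
  have "Gam e \<epsilon> ?x = (?x + (?x ^ q + ?x) * \<epsilon>) ^ (\<sigma> + 2) + (?x ^ q + ?x) ^ \<sigma>
    + (?x ^ (2 * q) + ?x\<^sup>2) * \<epsilon> + ?x ^ (q + 1) + ?x\<^sup>2"
    by (simp add: Gam_def Let_def q_def \<sigma>_def)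
  also have "\<dots> = a ^ (\<sigma> + 2) + b ^ \<sigma> + ((?x ^ q)\<^sup>2 + ?x\<^sup>2) * \<epsilon> + ?x ^ q * ?x + ?x\<^sup>2"
    unfolding t 1 p1 p2 ..
  also have "\<dots> = a ^ (\<sigma> + 2) + a * b + b ^ \<sigma>"
  proof -
    have "((?x ^ q)\<^sup>2 + ?x\<^sup>2) * \<epsilon> = b\<^sup>2 * \<epsilon>"
      using add_power2[of "?x ^ q" ?x] by (simp only: t)
    moreover have "?x ^ q * ?x + ?x\<^sup>2 = b * ?x"
      unfolding conj by (simp add: algebra_simps power2_eq_square)
    moreover have "b\<^sup>2 * \<epsilon> + b * ?x = a * b"
      by (simp add: algebra_simps power2_eq_square)
    ultimately show ?thesis by (simp only: add.assoc) (simp only: add.left_commute add.commute)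
  qed
  finally show ?thesis .
qed

lemma Gam_K [simp]: "Gam e \<epsilon> x \<in> K"
  by (rule coordinates[of x]) (simp add: Gam_coordinates K_closed)

section \<open>The powers \<sigma> and \<sigma> + 2, and the size of F_q\<close>

lemma \<sigma>_root:
  assumes "x \<in> K"
  obtains y where "y \<in> K" "y ^ \<sigma> = x"
proof (rule that)
  show "x ^ 2 ^ ((e - 1) div 2) \<in> K" using K_closed(3)[OF assms assms] .
  \<comment> \<open>The two exponents of 2 add up to \<open>e\<close>, so this power inverts
    x^\<sigma> on \<open>K\<close>.\<close>
  have "(e - 1) div 2 + (e + 1) div 2 = e" using odd_e by presburger
  then have "(x ^ 2 ^ ((e - 1) div 2)) ^ \<sigma> = x ^ q"
    by (simp add: \<sigma>_def q_def flip: power_mult power_add)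
  then show "(x ^ 2 ^ ((e - 1) div 2)) ^ \<sigma> = x" using assms by (simp add: K_iff)
qed

text \<open>
  Every plane that is not parallel to the axis meets the ovoid. The first coordinate of the point
  is chosen so that the second one enters the equation only through its \<open>\<sigma>\<close>-th power.
\<close>

lemma Gam_eq_tr_affine:
  obtains y where "tr (c + m * y) = Gam e \<epsilon> y"
proof -
  obtain m0 m1 where m: "m0 \<in> K" "m1 \<in> K" "m = m0 + m1 * \<epsilon>" by (rule coordinates)
  obtain z where z: "z \<in> K" "z ^ \<sigma> = tr c + (m0 + m1) * m1 + (m0 + m1) ^ (\<sigma> + 2)"
    using \<sigma>_root K_closed m(1,2) tr_K by metis
  have "tr (c + m * ((m0 + m1) + z * \<epsilon>)) = tr c + (m0 * z + m1 * (m0 + m1) + m1 * z)"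
    using m z(1) by (simp add: tr_add tr_prod_coordinates K_closed)
  also have "\<dots> = (m0 + m1) ^ (\<sigma> + 2) + (m0 + m1) * z + z ^ \<sigma>"
    unfolding z(2) by (simp add: algebra_simps)
  also have "\<dots> = Gam e \<epsilon> ((m0 + m1) + z * \<epsilon>)"
    using m z(1) by (simp add: Gam_coordinates K_closed)
  finally show ?thesis using that by blast
qed

text \<open>Comparing the \<sigma>-th power of z^\<sigma> z^2 = 1 with its square and using
  \<sigma>^2 = 2 q gives z^(2q) = z^4, so z^q = z^2. A second q-th power gives z = z^4, while on F_q
  the first relation reads z = z^2.\<close>

lemma power_eq_1_imp:
  assumes "(z::'a) ^ (\<sigma> + 2) = 1"
  shows "z ^ 4 = z" "z \<in> K \<Longrightarrow> z = 1"
proof -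
  have z: "z ^ \<sigma> * z\<^sup>2 = 1" using assms by (simp only: power_add)
  then have nz: "z \<noteq> 0" by auto
  have "z ^ (\<sigma> * \<sigma>) * (z ^ \<sigma>)\<^sup>2 = (z ^ \<sigma> * z\<^sup>2) ^ \<sigma>"
    by (simp add: power_mult_distrib power_mult) (metis power_mult mult.commute)
  also have "\<dots> = (z ^ \<sigma> * z\<^sup>2)\<^sup>2" by (simp add: z)
  finally have "z ^ (\<sigma> * \<sigma>) * (z ^ \<sigma>)\<^sup>2 = (z\<^sup>2)\<^sup>2 * (z ^ \<sigma>)\<^sup>2"
    by (simp add: power_mult_distrib mult.commute)
  with nz have "z ^ (\<sigma> * \<sigma>) = (z\<^sup>2)\<^sup>2" by simp
  then have "(z ^ q)\<^sup>2 = (z\<^sup>2)\<^sup>2"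
    by (simp add: \<sigma>_squared mult.commute[of 2] power_mult)
  then have zq: "z ^ q = z\<^sup>2" using power_2pow_inject[of "z ^ q" 1 "z\<^sup>2"] unfolding power_one_right by blast
  have "z = (z\<^sup>2) ^ q" using power_q_q[of z] zq by simp
  also have "\<dots> = (z ^ q)\<^sup>2" by (metis power_mult mult.commute)
  also have "\<dots> = z ^ 4" by (simp add: zq flip: power_mult)
  finally show "z ^ 4 = z" by simp
  show "z = 1" if "z \<in> K"
    using that zq nz by (simp add: K_iff power2_eq_square)
qed

lemma power_inj_on_K: "inj_on (\<lambda>x. x ^ (\<sigma> + 2)) K"
proof (rule inj_onI)
  fix x y assume xy: "x \<in> K" "y \<in> K" "x ^ (\<sigma> + 2) = y ^ (\<sigma> + 2)"
  show "x = y"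
  proof (cases "y = 0")
    case False
    with xy have "(x / y) ^ (\<sigma> + 2) = 1" by (simp only: power_divide) simp
    then show ?thesis using power_eq_1_imp(2)[of "x / y"] xy False by (simp add: K_closed)
  qed (use xy in auto)
qed

lemma power_surj_K:
  assumes "x \<in> K"
  obtains y where "y \<in> K" "y ^ (\<sigma> + 2) = x"
proof -
  have "(\<lambda>x. x ^ (\<sigma> + 2)) ` K = K"
    using power_inj_on_K K_closed(3) by (intro endo_inj_surj) (auto simp del: power_Suc)
  with assms have "x \<in> (\<lambda>x. x ^ (\<sigma> + 2)) ` K" by simp
  then show ?thesis using that by (elim imageE) simp
qed

lemma card_K: "card K \<ge> q"
proof -
  have "UNIV \<subseteq> (\<lambda>(a, b). a + b * \<epsilon>) ` (K \<times> K)"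
  proof
    fix x :: 'a
    obtain a b where "a \<in> K" "b \<in> K" "x = a + b * \<epsilon>" by (rule coordinates)
    then show "x \<in> (\<lambda>(a, b). a + b * \<epsilon>) ` (K \<times> K)" by (intro image_eqI[of _ _ "(a, b)"]) auto
  qed
  then have "CARD('a) \<le> card ((\<lambda>(a, b). a + b * \<epsilon>) ` (K \<times> K))"
    by (intro card_mono) auto
  also have "\<dots> \<le> card (K \<times> K)" by (rule card_image_le) simp
  finally have "q\<^sup>2 \<le> (card K)\<^sup>2"
    by (simp add: card q_def card_cartesian_product power2_eq_square)
  then show ?thesis by (simp add: power2_nat_le_eq_le)
qed

text \<open>By \<open>power_sum_eq\<close> the condition says that (1, a, a + 1) is off the curve C.
  If a^\<sigma> = a^2, then taking \<sigma>-th powers gives a^2 = a^4, so only 0 and 1 are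
  excluded.\<close>

lemma ex_K: obtains a where "a \<in> K" "a ^ \<sigma> + a\<^sup>2 \<noteq> 0"
proof -
  have "\<not> K \<subseteq> {0, 1}"
  proof
    assume "K \<subseteq> {0, 1}"
    then have "card K \<le> card {0, 1 :: 'a}" by (intro card_mono) auto
    also have "\<dots> \<le> 2" by (simp add: card_insert_if)
    finally show False using card_K q_ge_8 by simp
  qed
  then obtain a where a: "a \<in> K" "a \<noteq> 0" "a \<noteq> 1" by blast
  have "a ^ \<sigma> + a\<^sup>2 \<noteq> 0"
  proof
    assume "a ^ \<sigma> + a\<^sup>2 = 0"
    then have eq: "a ^ \<sigma> = a\<^sup>2" by (simp add: add_eq_0_iff)
    have "a\<^sup>2 = a ^ (q * 2)" using a(1) by (simp add: K_iff power_mult)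
    also have "\<dots> = (a ^ \<sigma>) ^ \<sigma>"
      using \<sigma>_squared by (simp add: mult.commute flip: power_mult)
    also have "\<dots> = (a ^ \<sigma>)\<^sup>2"
      by (subst eq) (simp add: mult.commute flip: power_mult)
    finally have "a\<^sup>2 = (a\<^sup>2)\<^sup>2" by (simp only: eq)
    then have "a = a\<^sup>2" using power_2pow_inject[of a 1 "a\<^sup>2"] unfolding power_one_right by blast
    with a show False by (simp add: power2_eq_square)
  qed
  with a that show ?thesis by blast
qed

lemma power_sum_eq: "a ^ (\<sigma> + 2) + (a + 1) ^ (\<sigma> + 2) + 1 = (a::'a) ^ \<sigma> + a\<^sup>2"
  by (simp add: power_add frobenius add_power2 algebra_simps power2_eq_square)

section \<open>The cone of zeros\<close>

lemma \<epsilon>_nonzero: "\<epsilon> \<noteq> 0"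
  using \<epsilon>_conj q_ge_8 by (auto simp: zero_power)

text \<open>Degree q (\<sigma> + 2) is reached only by the power of the bracket, whose term of
  degree q is \<epsilon> x^q T^q; all other terms of \<open>Gam\<close> have smaller degree.\<close>

lemma coeff_Gam_monom:
  "coeff (Gam e [:\<epsilon>:] [:0, x:]) (q * (\<sigma> + 2)) = (\<epsilon> * x ^ q) ^ (\<sigma> + 2)"
proof -
  let ?X = "monom x 1"
  have X: "[:0, x:] = ?X" by (simp add: monom_altdef)
  have Xn: "?X ^ n = monom (x ^ n) n" for n by (simp add: monom_power)
  have deg: "degree (?X ^ n) \<le> n" for n unfolding Xn by (rule degree_monom_le)
  define p where "p = ?X + (?X ^ q + ?X) * [:\<epsilon>:]"
  have "degree (?X ^ q + ?X) \<le> q"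
    using deg[of q] deg[of 1] q_ge_8 by (intro degree_add_le) auto
  then have degp: "degree p \<le> q" and deg1: "degree (?X ^ q + ?X) \<le> q"
    unfolding p_def using deg[of 1] q_ge_8
    by (auto intro!: degree_add_le order.trans[OF degree_mult_le])
  have cp: "coeff p q = \<epsilon> * x ^ q"
    unfolding p_def Xn using q_ge_8 by (simp add: mult.commute[of _ "[:\<epsilon>:]"])
  have "coeff (p ^ (\<sigma> + 2)) (q * (\<sigma> + 2)) = (\<epsilon> * x ^ q) ^ (\<sigma> + 2)"
    using coeff_power_top[OF degp, of "\<sigma> + 2"] by (simp only: cp mult.commute)
  moreover have "coeff ((?X ^ q + ?X) ^ \<sigma>) (q * (\<sigma> + 2)) = 0"
  proof (rule coeff_eq_0)
    have "degree ((?X ^ q + ?X) ^ \<sigma>) \<le> q * \<sigma>"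
      using degree_power_le[of "?X ^ q + ?X" \<sigma>] deg1 by (meson le_trans mult_le_mono1)
    also have "\<dots> < q * (\<sigma> + 2)" using q_ge_8 by simp
    finally show "degree ((?X ^ q + ?X) ^ \<sigma>) < q * (\<sigma> + 2)" .
  qed
  moreover have less: "2 * q < q * (\<sigma> + 2)" using q_ge_8 \<sigma>_pos by simp
  moreover have "coeff ((?X ^ (2 * q) + ?X\<^sup>2) * [:\<epsilon>:]) (q * (\<sigma> + 2)) = 0"
    unfolding Xn using less q_ge_8 by (simp add: mult.commute[of _ "[:\<epsilon>:]"])
  moreover have "coeff (?X ^ (q + 1)) (q * (\<sigma> + 2)) = 0"
    unfolding Xn using less q_ge_8 by simp
  moreover have "coeff (?X\<^sup>2) (q * (\<sigma> + 2)) = 0"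
    unfolding Xn using less q_ge_8 by simp
  ultimately show ?thesis
    unfolding X Gam_def Let_def q_def[symmetric] \<sigma>_def[symmetric] p_def[symmetric] by simp
qed

lemma degree_le_affine_poly4: "degree_le (affine_poly4 e \<epsilon>) (q * (\<sigma> + 2))"
proof -
  have less: "2 * q \<le> q * (\<sigma> + 2)" "q * \<sigma> \<le> q * (\<sigma> + 2)" by simp_all
  have var: "degree_le (Var i ^ n :: (5, 'a) mpoly) n" for i n
    using degree_le_power[OF degree_le_Var, of i n] by simp
  have var1: "degree_le (Var i :: (5, 'a) mpoly) n" if "n \<ge> 1" for i n
    using degree_le_mono[OF degree_le_Var that] .
  have c: "degree_le (f * Const \<epsilon> :: (5, 'a) mpoly) d" if "degree_le f d" for f d
    using degree_le_mult[OF that degree_le_Const] by simp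
  have t: "degree_le (Var i ^ q + Var i :: (5, 'a) mpoly) q" for i
    using q_ge_8 by (intro degree_le_add var var1) simp
  have gam: "degree_le (Gam e (Const \<epsilon>) (Var i) :: (5, 'a) mpoly) (q * (\<sigma> + 2))" for i
    unfolding Gam_def Let_def q_def[symmetric] \<sigma>_def[symmetric]
  proof (intro degree_le_add)
    show "degree_le ((Var i + (Var i ^ q + Var i) * Const \<epsilon>) ^ (\<sigma> + 2) :: (5, 'a) mpoly) (q * (\<sigma> + 2))"
      by (subst mult.commute, intro degree_le_power degree_le_add c t var1) (use q_ge_8 in simp)
    show "degree_le ((Var i ^ q + Var i) ^ \<sigma> :: (5, 'a) mpoly) (q * (\<sigma> + 2))"
      by (rule degree_le_mono[OF degree_le_power[OF t]]) simp
    show "degree_le ((Var i ^ (2 * q) + (Var i)\<^sup>2) * Const \<epsilon> :: (5, 'a) mpoly) (q * (\<sigma> + 2))"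
      by (intro c degree_le_add degree_le_mono[OF var]) (use q_ge_8 less in linarith)+
    show "degree_le (Var i ^ (q + 1) :: (5, 'a) mpoly) (q * (\<sigma> + 2))"
      "degree_le ((Var i)\<^sup>2 :: (5, 'a) mpoly) (q * (\<sigma> + 2))"
      by (intro degree_le_mono[OF var]; use q_ge_8 less in linarith)+
  qed
  have "degree_le (Var 4 ^ q :: (5, 'a) mpoly) (q * (\<sigma> + 2))" "degree_le (Var 4 :: (5, 'a) mpoly) (q * (\<sigma> + 2))"
    by (intro degree_le_mono[OF var] var1; use q_ge_8 less in linarith)+
  then show ?thesis
    unfolding affine_poly4_def q_def[symmetric]
    by (intro degree_le_diff degree_le_add degree_le_sum gam)
qed

lemma coeff_graded_affine_poly4:
  "coeff (graded_eval v (affine_poly4 e \<epsilon>)) (q * (\<sigma> + 2)) =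
    \<epsilon> ^ (\<sigma> + 2) * (v $ 1 ^ (\<sigma> + 2) + v $ 2 ^ (\<sigma> + 2) + v $ 3 ^ (\<sigma> + 2)) ^ q"
proof -
  have "2 * q \<le> q * (\<sigma> + 2)" by simp
  then have less: "q < q * (\<sigma> + 2)" "1 < q * (\<sigma> + 2)" using q_ge_8 by linarith+
  have X: "[:0, x:] = monom x 1" for x :: 'a by (simp add: monom_altdef)
  have "coeff ([:0, x:] ^ q) (q * (\<sigma> + 2)) = 0" "coeff [:0, x:] (q * (\<sigma> + 2)) = 0" for x :: 'a
    unfolding X monom_power using less by auto
  then have "coeff (graded_eval v (affine_poly4 e \<epsilon>)) (q * (\<sigma> + 2)) =
    (\<epsilon> * v $ 1 ^ q) ^ (\<sigma> + 2) + (\<epsilon> * v $ 2 ^ q) ^ (\<sigma> + 2) + (\<epsilon> * v $ 3 ^ q) ^ (\<sigma> + 2)"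
    by (simp add: affine_poly4_def q_def[symmetric] grade_hom.subst_diff grade_hom.subst_add
      grade_hom.subst_power grade_hom.subst_sum grade_hom.subst_Gam coeff_Gam_monom diff_eq_add uminus_eq add.assoc
      del: add_2_eq_Suc')
  \<comment> \<open>Up to a common factor the three terms are q-th powers, so Frobenius collects
    them into the q-th power of the equation of C.\<close>
  moreover have "(\<epsilon> * x ^ q) ^ (\<sigma> + 2) = \<epsilon> ^ (\<sigma> + 2) * (x ^ (\<sigma> + 2)) ^ q" for x
    by (simp only: power_mult_distrib power_mult[symmetric] mult.commute)
  ultimately show ?thesis
    by (simp only: frobenius distrib_left)
qed

lemma total_degree_affine_poly4: "total_degree (affine_poly4 e \<epsilon>) = q * (\<sigma> + 2)"
proof (rule total_degree_eqI[OF degree_le_affine_poly4])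
  show "coeff (graded_eval (vec5 0 1 0 0 0) (affine_poly4 e \<epsilon>)) (q * (\<sigma> + 2)) \<noteq> 0"
    unfolding coeff_graded_affine_poly4 using \<epsilon>_nonzero by (simp add: zero_power)
qed

text \<open>Vectors instead of points, with 0 among them, so that spans of points become dimensions
  of \<open>Z \<inter> U\<close>.\<close>

definition Z :: "('a ^ 5) set" where
  "Z = {v. eval_poly (homogenization 0 (affine_poly4 e \<epsilon>)) v = 0}"

lemma Z_infinity:
  assumes "v $ 0 = 0"
  shows "v \<in> Z \<longleftrightarrow> v $ 1 ^ (\<sigma> + 2) + v $ 2 ^ (\<sigma> + 2) + v $ 3 ^ (\<sigma> + 2) = 0"
  using \<epsilon>_nonzero q_ge_8
  by (simp add: Z_def eval_homogenization_infinity[OF assms] total_degree_affine_poly4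
    coeff_graded_affine_poly4 del: add_2_eq_Suc')

lemma Z_affine:
  assumes "v $ 0 \<noteq> 0"
  shows "v \<in> Z \<longleftrightarrow> tr (v $ 4 / v $ 0) =
    Gam e \<epsilon> (v $ 1 / v $ 0) + Gam e \<epsilon> (v $ 2 / v $ 0) + Gam e \<epsilon> (v $ 3 / v $ 0)"
  using assms
  by (simp add: Z_def eval_homogenization_affine[OF assms] affine_poly4_def eval_hom.subst_diff
    eval_hom.subst_add eval_hom.subst_sum eval_hom.subst_power eval_hom.subst_Gam tr_def q_def add.assoc)

section \<open>From points of the hypersurface to vectors of its cone\<close>

lemma Z_scale:
  assumes "v \<in> Z"
  shows "c *s v \<in> Z"
proof (cases "c = 0 \<or> v $ 0 = 0")
  case True
  then show ?thesis
  proof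
    assume "v $ 0 = 0"
    with assms have "c ^ (\<sigma> + 2) * (v $ 1 ^ (\<sigma> + 2) + v $ 2 ^ (\<sigma> + 2) + v $ 3 ^ (\<sigma> + 2)) = 0"
      by (simp only: Z_infinity mult_zero_right)
    with \<open>v $ 0 = 0\<close> show ?thesis
      by (simp only: Z_infinity vector_smult_component mult_zero_right power_mult_distrib distrib_left)
  qed (simp add: Z_infinity zero_power)
next
  case False
  with assms show ?thesis by (simp add: Z_affine)
qed

text \<open>A nonzero vector of \<open>Z \<inter> U\<close> spans a point contained in
  \<open>Z \<inter> U\<close> by \<open>Z_scale\<close>, so points and vectors have the same
  span.\<close>

lemma proj_dim_span_V4:
  assumes U: "vec.subspace U"
  shows "proj_dim (proj_span {P \<in> V4 e \<epsilon>. P \<subseteq> U}) = int (vec.dim (Z \<inter> U)) - 1"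
proof -
  have V4: "V4 e \<epsilon> = {P \<in> proj_points. P \<subseteq> Z}"
    by (auto simp: V4_def proj_zeros_def Z_def)
  have "v \<in> vec.span (\<Union>{P \<in> V4 e \<epsilon>. P \<subseteq> U})" if v: "v \<in> Z \<inter> U" for v
  proof (cases "v = 0")
    case False
    have "vec.span {v} \<in> proj_points"
      using False by (simp add: proj_points_def proj_dim_def)
    moreover have "vec.span {v} \<subseteq> Z \<inter> U"
      using v U by (auto simp: vec.span_singleton Z_scale vec.subspace_scale)
    ultimately have "vec.span {v} \<in> {P \<in> V4 e \<epsilon>. P \<subseteq> U}" by (simp add: V4)
    then show ?thesis by (meson UnionI singletonI vec.span_base)
  qed (simp add: vec.span_zero)
  then have "vec.span (\<Union>{P \<in> V4 e \<epsilon>. P \<subseteq> U}) = vec.span (Z \<inter> U)"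
    by (intro vec.span_eq[THEN iffD2] conjI) (auto simp: V4 intro: vec.span_base)
  then show ?thesis by (simp add: proj_dim_def proj_span_def)
qed

text \<open>Here \<open>k\<close> is a projective and \<open>m\<close> a vector space dimension, so
  the minimum in the definition is \<open>m - 1\<close>.\<close>

lemma cutting_gap_eqI:
  assumes "\<And>U. vec.subspace U \<Longrightarrow> vec.dim U = k + 1 \<Longrightarrow> vec.dim (Z \<inter> U) \<ge> m"
    and "vec.subspace U0" "vec.dim U0 = k + 1" "vec.dim (Z \<inter> U0) = m"
  shows "cutting_gap k (V4 e \<epsilon>) = int (k + 1) - int m"
proof -
  let ?S = "{proj_dim (proj_span {P \<in> V4 e \<epsilon>. P \<subseteq> U}) | U. vec.subspace U \<and> proj_dim U = int k}"
  have "Min ?S = int m - 1"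
  proof (rule Min_eqI)
    show "finite ?S" by (rule finite_subset[of _ "range (\<lambda>U. proj_dim (proj_span {P \<in> V4 e \<epsilon>. P \<subseteq> U}))"]) auto
    show "int m - 1 \<le> y" if "y \<in> ?S" for y
    proof -
      from that obtain U where U: "vec.subspace U" "vec.dim U = k + 1"
        and y: "y = proj_dim (proj_span {P \<in> V4 e \<epsilon>. P \<subseteq> U})"
        by (auto simp: proj_dim_def)
      show ?thesis using assms(1)[OF U] U(1) by (simp add: y proj_dim_span_V4)
    qed
    show "int m - 1 \<in> ?S"
      using assms(2-4) proj_dim_span_V4[OF assms(2)]
      by (auto simp: proj_dim_def[of U0] intro!: exI[of _ U0])
  qed
  then show ?thesis by (simp add: cutting_gap_def)
qed

section \<open>Cutting gaps\<close>

lemma Gam_sum_K_direction: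
  assumes "a \<in> K" "t0 \<in> K" "t1 \<in> K"
  defines "t \<equiv> t0 + t1 * \<epsilon>"
  shows "Gam e \<epsilon> t + Gam e \<epsilon> (a * t) + Gam e \<epsilon> ((a + 1) * t) = (a ^ \<sigma> + a\<^sup>2) * t0 ^ (\<sigma> + 2)"
proof -
  have scale: "Gam e \<epsilon> (c * t) = c ^ (\<sigma> + 2) * t0 ^ (\<sigma> + 2) + c\<^sup>2 * (t0 * t1) + c ^ \<sigma> * t1 ^ \<sigma>"
    if "c \<in> K" for c
  proof -
    have "c * t = c * t0 + c * t1 * \<epsilon>" by (simp add: t_def algebra_simps)
    then show ?thesis
      using Gam_coordinates[of "c * t0" "c * t1"] that assms
      by (simp add: K_closed power_mult_distrib power2_eq_square mult_ac)
  qed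
  have "Gam e \<epsilon> t + Gam e \<epsilon> (a * t) + Gam e \<epsilon> (b * t) =
    (a ^ (\<sigma> + 2) + b ^ (\<sigma> + 2) + 1) * t0 ^ (\<sigma> + 2)
    + (1 + a\<^sup>2 + b\<^sup>2) * (t0 * t1) + (1 + a ^ \<sigma> + b ^ \<sigma>) * t1 ^ \<sigma>" if "b \<in> K" for b
    using scale[of 1] scale[of a] scale[OF that] assms(1)
    by (simp add: distrib_right distrib_left ac_simps del: add_2_eq_Suc')
  from this[OF K_closed(1)[OF assms(1) K_01(2)]]
  have "Gam e \<epsilon> t + Gam e \<epsilon> (a * t) + Gam e \<epsilon> ((a + 1) * t) =
    (a ^ (\<sigma> + 2) + (a + 1) ^ (\<sigma> + 2) + 1) * t0 ^ (\<sigma> + 2)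
    + (1 + a\<^sup>2 + (a + 1)\<^sup>2) * (t0 * t1) + (1 + a ^ \<sigma> + (a + 1) ^ \<sigma>) * t1 ^ \<sigma>" .
  \<comment> \<open>The scalars 1, a and a + 1 sum to 0 and the powers 2 and \<sigma> are additive,
    so every term containing \<open>t1\<close> drops out.\<close>
  also have "1 + a\<^sup>2 + (a + 1)\<^sup>2 = 0" by (simp add: add_power2 ac_simps)
  also have "1 + a ^ \<sigma> + (a + 1) ^ \<sigma> = 0" by (simp add: frobenius ac_simps)
  finally show ?thesis by (simp only: power_sum_eq) simp
qed

lemma ex_line_disjoint_Z:
  obtains U where "vec.subspace U" "vec.dim U = 2" "Z \<inter> U = {0}"
proof -
  obtain a where a: "a \<in> K" "a ^ \<sigma> + a\<^sup>2 \<noteq> 0" using ex_K .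
  define \<kappa> where "\<kappa> = a ^ \<sigma> + a\<^sup>2"
  have \<kappa>: "\<kappa> \<in> K" "\<kappa> \<noteq> 0" using a by (simp_all add: \<kappa>_def K_closed)
  \<comment> \<open>The map is 0 at both 0 and 1, hence not onto the finite set \<open>K\<close>;
    \<open>g\<close> will be an omitted value.\<close>
  have "\<not> K \<subseteq> (\<lambda>x. x ^ (\<sigma> + 2) + x) ` K"
  proof
    assume "K \<subseteq> (\<lambda>x. x ^ (\<sigma> + 2) + x) ` K"
    then have "inj_on (\<lambda>x. x ^ (\<sigma> + 2) + x) K" by (rule finite_surj_inj[rotated]) simp
    from inj_onD[OF this, of 0 1] show False by simp
  qed
  then obtain g where g: "g \<in> K" "\<And>x. x \<in> K \<Longrightarrow> x ^ (\<sigma> + 2) + x \<noteq> g" by blast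
  \<comment> \<open>The last coordinates are chosen so that at X_0 = 1 the trace of X_4 is \<kappa>
    g + \<kappa> t0, with t0 the first coordinate of X_1. Membership in \<open>Z\<close> would then
    write \<open>g\<close> as t0^(\<sigma> + 2) + t0.\<close>
  define p where "p = vec5 1 0 0 0 (\<kappa> * g * \<epsilon>)"
  define r where "r = vec5 0 1 a (a + 1) (\<kappa> + \<kappa> * \<epsilon>)"
  have zero: "v = 0" if "v \<in> Z" and v: "v = l *s p + m *s r" for v l m
  \<comment> \<open>For \<open>l = 0\<close> this is the point of the line at infinity, which lies
    over (1, a, a + 1), off C.\<close>
  proof (cases "l = 0")
    case True
    then have "v $ 0 = 0" "v $ 1 = m" "v $ 2 = m * a" "v $ 3 = m * (a + 1)"
      by (simp_all add: v r_def)
    with \<open>v \<in> Z\<close> have "m ^ (\<sigma> + 2) + (m * a) ^ (\<sigma> + 2) + (m * (a + 1)) ^ (\<sigma> + 2) = 0"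
      by (simp only: Z_infinity)
    moreover have "m ^ (\<sigma> + 2) + (m * a) ^ (\<sigma> + 2) + (m * b) ^ (\<sigma> + 2) =
      m ^ (\<sigma> + 2) * (a ^ (\<sigma> + 2) + b ^ (\<sigma> + 2) + 1)" for b
      by (simp add: power_mult_distrib distrib_left ac_simps del: add_2_eq_Suc')
    ultimately have "m = 0" using a(2) by (simp only: power_sum_eq) auto
    with True v show ?thesis by simp
  next
    case False
    obtain t0 t1 where t: "t0 \<in> K" "t1 \<in> K" "m / l = t0 + t1 * \<epsilon>" by (rule coordinates)
    have "tr (\<kappa> * g * \<epsilon> + (\<kappa> + \<kappa> * \<epsilon>) * (m / l)) =
      Gam e \<epsilon> (m / l) + Gam e \<epsilon> (a * (m / l)) + Gam e \<epsilon> ((a + 1) * (m / l))"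
      using \<open>v \<in> Z\<close> False
      by (simp add: Z_affine v p_def r_def add_divide_distrib mult.commute)
    moreover have "tr (\<kappa> * g * \<epsilon> + (\<kappa> + \<kappa> * \<epsilon>) * (m / l)) = \<kappa> * g + \<kappa> * t0"
      using \<kappa> g t by (simp add: tr_add tr_mult_K tr_prod_coordinates K_closed add_ac)
    ultimately have "\<kappa> * (t0 ^ (\<sigma> + 2) + t0) = \<kappa> * g"
      using Gam_sum_K_direction[OF a(1) t(1,2)]
      by (simp add: t(3) \<kappa>_def[symmetric] distrib_left del: add_2_eq_Suc')
        (metis add_self_left add.commute)
    with \<kappa> g(2)[OF t(1)] show ?thesis by simp
  qed
  have "p \<noteq> 0" by (simp add: p_def vec_eq_iff_5)
  moreover have "r \<notin> vec.span {p}"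
    by (auto simp: vec.span_singleton p_def r_def vec_eq_iff_5)
  ultimately have "vec.dim (vec.span {r, p}) = 2"
    by (simp add: vec.dim_insert)
  moreover have "Z \<inter> vec.span {r, p} = {0}"
  proof -
    have "v = 0" if v: "v \<in> Z" "v \<in> vec.span {r, p}" for v
    proof -
      obtain m l where "v - m *s r = l *s p"
        using v(2) by (auto simp: vec.span_insert[of r] vec.span_singleton)
      then have "v = l *s p + m *s r" by (metis diff_add_cancel)
      with v(1) show ?thesis by (rule zero)
    qed
    moreover have "0 \<in> Z" by (simp add: Z_infinity zero_power)
    ultimately show ?thesis by (auto simp: vec.span_zero)
  qed
  ultimately show ?thesis using that vec.subspace_span by blast
qed

section \<open>Every plane meets the hypersurface, and some line misses C\<close>

lemma obtain_nonzero:
  assumes "vec.dim (S :: ('a ^ 5) set) \<ge> 1"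
  obtains v where "v \<in> S" "v \<noteq> 0"
proof -
  have "\<not> S \<subseteq> {0}" using assms vec.dim_eq_0[of S] by linarith
  then show ?thesis using that by blast
qed

text \<open>
  On the hyperplane \<open>X\<^sub>1 = X\<^sub>2\<close> the first two summands of the equation cancel and the hypersurface
  becomes a cone over a curve that every line of its plane meets.
\<close>

lemma plane_meets_Z:
  assumes U: "vec.subspace U" and dim: "vec.dim U = 3"
  shows "vec.dim (Z \<inter> U) \<ge> 1"
proof -
  have sub: "vec.subspace {v \<in> W. v $ i = 0}" if "vec.subspace W" for W :: "('a ^ 5) set" and i
    using that by (auto simp: vec.subspace_def)
  have drop: "vec.dim W \<le> vec.dim {v \<in> W. v $ i = 0} + 1" if "vec.subspace W" for W :: "('a ^ 5) set" and i
    using that by (intro dim_kernel_functional_ge) auto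
  define L where "L = {v \<in> U. v $ 1 + v $ 2 = 0}"
  have L: "vec.subspace L"
    using U by (auto simp: L_def vec.subspace_def add_eq_0_iff)
  have "vec.dim U \<le> vec.dim L + 1"
    unfolding L_def using U by (intro dim_kernel_functional_ge) (auto simp: algebra_simps)
  then have dimL: "vec.dim L \<ge> 2" using dim by simp
  have inL: "v \<in> U" "v $ 1 = v $ 2" if "v \<in> L" for v
    using that by (auto simp: L_def add_eq_0_iff)
  have inf: "v \<in> Z \<inter> U" if "v \<in> L" "v $ 0 = 0" "v $ 3 = 0" for v
    using inL[OF that(1)] that by (simp add: Z_infinity)
  have "\<exists>w\<in>Z \<inter> U. w \<noteq> 0"
  proof (cases "\<exists>b\<in>L. b $ 0 \<noteq> 0")
    case True
    then obtain b' where b': "b' \<in> L" "b' $ 0 \<noteq> 0" by blast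
    define b where "b = (1 / b' $ 0) *s b'"
    have b: "b \<in> L" "b $ 0 = 1"
      using b' L by (simp_all add: b_def vec.subspace_scale)
    have "vec.dim {v \<in> L. v $ 0 = 0} \<ge> 1" using drop[OF L, of 0] dimL by simp
    then obtain v where v: "v \<in> L" "v $ 0 = 0" "v \<noteq> 0" using obtain_nonzero by blast
    show ?thesis
    proof (cases "v $ 3 = 0")
      case True
      then show ?thesis using inf v by blast
    next
      case False
      \<comment> \<open>On the affine points b + s v of \<open>L\<close>, X_4 is an affine function
        of X_3 because \<open>v $ 3\<close> is nonzero; \<open>y\<close> is the value of X_3 to aim
        for.\<close>
      obtain y where y: "tr (b $ 4 + v $ 4 * b $ 3 / v $ 3 + v $ 4 / v $ 3 * y) = Gam e \<epsilon> y"
        by (rule Gam_eq_tr_affine)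
      define w where "w = b + ((y + b $ 3) / v $ 3) *s v"
      have w: "w \<in> L" using L b v by (simp add: w_def vec.subspace_add vec.subspace_scale)
      have w0: "w $ 0 = 1" by (simp add: w_def b v)
      have w3: "w $ 3 = y" using False by (simp add: w_def add.commute[of y])
      have w4: "w $ 4 = b $ 4 + v $ 4 * b $ 3 / v $ 3 + v $ 4 / v $ 3 * y"
        using False by (simp add: w_def field_simps)
      have "w \<in> Z"
        using y inL(2)[OF w] by (simp add: Z_affine w0 w3 w4)
      moreover have "w \<noteq> 0" using w0 by (metis zero_index zero_neq_one)
      ultimately show ?thesis using inL(1)[OF w] by blast
    qed
  next
    case False
    have "vec.dim {v \<in> L. v $ 3 = 0} \<ge> 1" using drop[OF L, of 3] dimL by simp
    then obtain v where "v \<in> L" "v $ 3 = 0" "v \<noteq> 0" using obtain_nonzero by blast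
    then show ?thesis using inf False by blast
  qed
  then have "\<not> Z \<inter> U \<subseteq> {0}" by blast
  then show ?thesis using vec.dim_eq_0[of "Z \<inter> U"] by linarith
qed

text \<open>
  If the power map is not surjective and adding \<open>1\<close> preserved its range \<open>P\<close>, then \<open>P\<close> would be a
  proper subfield, so \<open>\<bar>P\<bar>\<^sup>2 \<le> \<bar>F\<bar>\<close>. But the fibres of the power map have at most four elements.
\<close>

lemma ex_one_plus_power_not_power:
  assumes "\<not> surj (\<lambda>x::'a. x ^ (\<sigma> + 2))"
  obtains v :: 'a where "1 + v ^ (\<sigma> + 2) \<notin> range (\<lambda>x. x ^ (\<sigma> + 2))"
proof (rule ccontr)
  define k where "k = \<sigma> + 2"
  define P where "P = range (\<lambda>x::'a. x ^ k)"
  have k: "k > 0" by (simp add: k_def)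
  assume "\<not> thesis"
  with that have one: "1 + v ^ k \<in> P" for v by (auto simp: P_def k_def)
  \<comment> \<open>For nonzero y, x + y = y (1 + x / y) is a product of two k-th powers.\<close>
  have add: "x + y \<in> P" if "x \<in> P" "y \<in> P" for x y
  proof (cases "y = 0")
    case False
    obtain u v where uv: "x = u ^ k" "y = v ^ k" using \<open>x \<in> P\<close> \<open>y \<in> P\<close> by (auto simp: P_def)
    obtain w where "1 + (u / v) ^ k = w ^ k" using one[of "u / v"] by (auto simp: P_def)
    then have "x + y = (v * w) ^ k"
      using False uv by (simp add: power_mult_distrib power_divide field_simps)
    then show ?thesis by (auto simp: P_def)
  qed (use that in simp)
  have div: "x / y \<in> P" if "x \<in> P" "y \<in> P" for x y
    using that by (auto simp: P_def simp flip: power_divide)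
  obtain z where z: "z \<notin> P" using assms by (auto simp: P_def k_def)
  \<comment> \<open>Two different pairs with the same image would express \<open>z\<close> as a
    quotient of elements of \<open>P\<close>.\<close>
  have "inj_on (\<lambda>(x, y). x + z * y) (P \<times> P)"
  proof (rule inj_onI, clarify)
    fix x y x' y' assume P: "x \<in> P" "y \<in> P" "x' \<in> P" "y' \<in> P" and eq: "x + z * y = x' + z * y'"
    have "z * (y + y') = x + x'"
    proof -
      have "z * (y + y') = (x + z * y) + x + z * y'" by (simp add: algebra_simps)
      also have "\<dots> = x + x'" unfolding eq by (simp add: algebra_simps)
      finally show ?thesis .
    qed
    then have "y + y' = 0"
      using z div[OF add[OF P(1,3)] add[OF P(2,4)]] by (metis nonzero_eq_divide_eq)
    with eq show "x = x' \<and> y = y'" by (simp add: add_eq_0_iff)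
  qed
  then have "card (P \<times> P) \<le> CARD('a)" by (rule card_inj_on_le) auto
  then have P2: "(card P)\<^sup>2 \<le> CARD('a)" by (simp add: card_cartesian_product power2_eq_square)
  \<comment> \<open>By \<open>power_eq_1_imp\<close>, nonzero elements with equal k-th powers differ
    by a factor in \<open>R\<close>.\<close>
  define R where "R = {x::'a. x ^ 4 = x}"
  have "card R \<le> 4"
  proof -
    let ?p = "monom 1 4 + monom 1 1 :: 'a poly"
    have "coeff ?p 4 = 1" by simp
    then have "?p \<noteq> 0" by (metis coeff_0 zero_neq_one)
    moreover have "degree ?p \<le> 4" by (intro degree_add_le) (auto simp: degree_monom_eq)
    moreover have "R = {x. poly ?p x = 0}" by (auto simp: R_def poly_monom add_eq_0_iff)
    ultimately show ?thesis using card_poly_roots_bound[of ?p] by simp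
  qed
  define root where "root x = (SOME y::'a. y ^ k = x)" for x
  have root: "root (x ^ k) ^ k = x ^ k" for x unfolding root_def by (rule someI) simp
  \<comment> \<open>Each element is the chosen root of its own k-th power times an element of
    \<open>R\<close>. So q^2 is at most 4 |P|, hence at most 4 q, contradicting q >= 8.\<close>
  have "UNIV \<subseteq> (\<lambda>(x, y). x * root y) ` (R \<times> P)"
  proof
    fix x :: 'a
    define y where "y = root (x ^ k)"
    have y: "y ^ k = x ^ k" by (simp add: y_def root)
    show "x \<in> (\<lambda>(x, y). x * root y) ` (R \<times> P)"
    proof (cases "x = 0")
      case True
      then show ?thesis by (intro image_eqI[of _ _ "(0, 0)"]) (use k in \<open>auto simp: R_def P_def image_iff intro!: exI[of _ 0]\<close>)
    next
      case False
      with y k have "y \<noteq> 0" by (metis power_eq_0_iff)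
      have "(x / y) ^ k = 1" using y False by (simp add: power_divide)
      then have "x / y \<in> R" unfolding R_def k_def using power_eq_1_imp(1) by blast
      with \<open>y \<noteq> 0\<close> show ?thesis
        by (intro image_eqI[of _ _ "(x / y, x ^ k)"]) (auto simp: y_def[symmetric] P_def)
    qed
  qed
  then have "CARD('a) \<le> card ((\<lambda>(x, y). x * root y) ` (R \<times> P))" by (intro card_mono) auto
  also have "\<dots> \<le> card (R \<times> P)" by (rule card_image_le) simp
  also have "\<dots> \<le> 4 * card P" using \<open>card R \<le> 4\<close> by (simp add: card_cartesian_product)
  finally have "q\<^sup>2 \<le> 4 * card P" by (simp add: card q_def)
  moreover have "card P \<le> q"
    using P2 by (simp add: card q_def power2_nat_le_eq_le)
  moreover have "8 * q \<le> q\<^sup>2" using q_ge_8 by (simp add: power2_eq_square)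
  ultimately show False using q_ge_8 by simp
qed

text \<open>
  If the power map is bijective, the curve \<open>C: x\<^sup>k + y\<^sup>k + z\<^sup>k = 0\<close> has as many points as there
  are lines through a point. The point \<open>(1, a, a + 1)\<close> is not on \<open>C\<close>, but collinear with the points
  \<open>(1, 0, 1)\<close> and \<open>(0, 1, 1)\<close> of \<open>C\<close>, so some line through it misses \<open>C\<close>.
\<close>

lemma ex_line_missing_curve:
  obtains n1 n2 n3 :: 'a where "(n1, n2, n3) \<noteq> (0, 0, 0)"
    and "\<And>x y z. n1 * x + n2 * y + n3 * z = 0 \<Longrightarrow>
      x ^ (\<sigma> + 2) + y ^ (\<sigma> + 2) + z ^ (\<sigma> + 2) = 0 \<Longrightarrow> x = 0 \<and> y = 0 \<and> z = 0"
proof (cases "surj (\<lambda>x::'a. x ^ (\<sigma> + 2))")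
  case False
  obtain v :: 'a where v: "1 + v ^ (\<sigma> + 2) \<notin> range (\<lambda>x. x ^ (\<sigma> + 2))"
    using ex_one_plus_power_not_power[OF False] .
  show ?thesis
  \<comment> \<open>A nonzero point of C on the line v y + z = 0 would have y nonzero, and 1 +
    v^(\<sigma> + 2) would be a power of x / y.\<close>
  proof (rule that[of 0 v 1])
    fix x y z :: 'a
    assume "0 * x + v * y + 1 * z = 0" and eq: "x ^ (\<sigma> + 2) + y ^ (\<sigma> + 2) + z ^ (\<sigma> + 2) = 0"
    then have z: "z = v * y" by (simp add: add_eq_0_iff)
    have x: "x ^ (\<sigma> + 2) = (1 + v ^ (\<sigma> + 2)) * y ^ (\<sigma> + 2)"
      using eq unfolding z by (simp add: add.assoc add_eq_0_iff power_mult_distrib distrib_right del: add_2_eq_Suc')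
    have "y = 0"
    proof (rule ccontr)
      assume "y \<noteq> 0"
      with x have "1 + v ^ (\<sigma> + 2) = (x / y) ^ (\<sigma> + 2)"
        by (simp add: power_divide field_simps del: add_2_eq_Suc')
      with v show False by blast
    qed
    with x z show "x = 0 \<and> y = 0 \<and> z = 0" by auto
  qed simp
next
  case True
  define k where "k = \<sigma> + 2"
  have k: "k > 0" by (simp add: k_def)
  have surj: "surj (\<lambda>x::'a. x ^ k)" using True by (simp only: k_def)
  then have inj: "inj (\<lambda>x::'a. x ^ k)" by (rule finite_UNIV_surj_inj[rotated]) simp
  define root where "root = inv (\<lambda>x::'a. x ^ k)"
  have root: "root (x ^ k) = x" for x
    using inv_f_f[OF inj] by (simp add: root_def)
  obtain a where a: "a \<in> K" "a ^ \<sigma> + a\<^sup>2 \<noteq> 0" using ex_K .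
  \<comment> \<open>\<open>f\<close> projects the curve point (x, y, root (x^k + y^k)) from (1, a, a
    + 1). The images of (1, 0, 1) and (0, a, a) agree, so \<open>f\<close> is not onto, and a missed
    value (d1, d2) gives a line through the centre without points of C.\<close>
  define f where "f = (\<lambda>(x, y). (y + a * x, root (x ^ k + y ^ k) + (a + 1) * x))"
  have "f (1, 0) = f (0, a)" "f (0, 0) = (0, 0)"
    using root[of 1] root[of a] root[of 0] k by (simp_all add: f_def zero_power add.left_commute add.commute)
  then have "\<not> inj f" using injD[of f "(1, 0)" "(0, a)"] by (metis prod.inject zero_neq_one)
  then have "\<not> surj f" using finite_UNIV_surj_inj[OF finite, of f] by blast
  then obtain d1 d2 where "(d1, d2) \<notin> range f" by auto
  then have d: "f x \<noteq> (d1, d2)" for x by (metis rangeI)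
  have d0: "d1 \<noteq> 0 \<or> d2 \<noteq> 0" using d[of "(0, 0)"] \<open>f (0, 0) = (0, 0)\<close> by auto
  show ?thesis
  \<comment> \<open>These are the coefficients of d2 u + d1 w for u = y + a x and w = z + (a + 1)
    x.\<close>
  proof (rule that[of "d2 * a + d1 * (a + 1)" d2 d1])
    show "(d2 * a + d1 * (a + 1), d2, d1) \<noteq> (0, 0, 0)" using d0 by auto
    fix x y z :: 'a
    assume line: "(d2 * a + d1 * (a + 1)) * x + d2 * y + d1 * z = 0"
      and "x ^ (\<sigma> + 2) + y ^ (\<sigma> + 2) + z ^ (\<sigma> + 2) = 0"
    then have curve: "x ^ k + y ^ k = z ^ k" by (simp add: k_def add_eq_0_iff del: add_2_eq_Suc')
    define u where "u = y + a * x"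
    define w where "w = z + (a + 1) * x"
    have "d2 * u + d1 * w = 0"
      using line by (simp add: u_def w_def algebra_simps)
    then have ratio: "d2 * u = d1 * w" by (simp add: add_eq_0_iff)
    have "u = 0 \<and> w = 0"
    proof (rule ccontr)
      assume nz: "\<not> (u = 0 \<and> w = 0)"
      \<comment> \<open>(u, w) is a multiple of (d1, d2), and dividing the curve point by \<mu> puts
        (d1, d2) into the range of \<open>f\<close>.\<close>
      obtain \<mu> where \<mu>: "\<mu> \<noteq> 0" "u = \<mu> * d1" "w = \<mu> * d2"
      proof (cases "d1 = 0")
        case True
        then show ?thesis using that[of "w / d2"] ratio d0 nz by auto
      next
        case False
        with ratio nz have "u \<noteq> 0" by auto
        with False show ?thesis using that[of "u / d1"] ratio by (auto simp: field_simps)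
      qed
      have "(x / \<mu>) ^ k + (y / \<mu>) ^ k = (z / \<mu>) ^ k"
        using curve by (simp add: power_divide flip: add_divide_distrib)
      then have "f (x / \<mu>, y / \<mu>) = (u / \<mu>, w / \<mu>)"
        by (simp add: f_def root u_def w_def add_divide_distrib)
      with \<mu> d show False by simp
    qed
    then have y: "y = a * x" and z: "z = (a + 1) * x"
      by (auto simp: u_def w_def add_eq_0_iff)
    \<comment> \<open>The point is now x times the centre (1, a, a + 1), which is off C.\<close>
    have "(a ^ k + c ^ k + 1) * x ^ k = x ^ k + (a * x) ^ k + (c * x) ^ k" for c
      by (simp add: power_mult_distrib algebra_simps)
    then have "(a ^ k + (a + 1) ^ k + 1) * x ^ k = (x ^ k + y ^ k) + z ^ k"
      unfolding y z .
    also have "\<dots> = 0" unfolding curve by (rule add_self)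
    finally have "(a ^ k + (a + 1) ^ k + 1) * x ^ k = 0" .
    then have "x = 0" using a unfolding k_def power_sum_eq by auto
    then show "x = 0 \<and> y = 0 \<and> z = 0" by (simp add: y z)
  qed
qed

section \<open>The hyperplane at infinity: a plane with a single point, and the spanning of
  solids\<close>

lemma dim_infinity: "vec.dim {v :: 'a ^ 5. v $ 0 = 0} = 4"
  using dim_kernel_functional[of "UNIV :: ('a ^ 5) set" "\<lambda>v. v $ 0" "vec5 1 0 0 0 0"]
  by (simp add: card_cart_basis)

lemma subspace_infinity: "vec.subspace {v :: 'a ^ 5. v $ 0 = 0}"
  by (simp add: vec.subspace_def)

text \<open>The plane joins the vertex (0,0,0,0,1) to a line missing C, so only multiples of the
  vertex lie in \<open>Z\<close>. The lower bound is an instance of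
  \<open>plane_meets_Z\<close>.\<close>

lemma ex_plane_one_point:
  obtains U where "vec.subspace U" "vec.dim U = 3" "vec.dim (Z \<inter> U) = 1"
proof -
  obtain n1 n2 n3 :: 'a where n: "(n1, n2, n3) \<noteq> (0, 0, 0)"
    and curve: "\<And>x y z. n1 * x + n2 * y + n3 * z = 0 \<Longrightarrow>
      x ^ (\<sigma> + 2) + y ^ (\<sigma> + 2) + z ^ (\<sigma> + 2) = 0 \<Longrightarrow> x = 0 \<and> y = 0 \<and> z = 0"
    using ex_line_missing_curve by blast
  let ?H = "{v :: 'a ^ 5. v $ 0 = 0}"
  let ?l = "\<lambda>v :: 'a ^ 5. n1 * v $ 1 + n2 * v $ 2 + n3 * v $ 3"
  define U where "U = {v \<in> ?H. ?l v = 0}"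
  have lin: "?l (v + w) = ?l v + ?l w" "?l (c *s v) = c * ?l v" for v w c
    by (simp_all add: algebra_simps)
  have U: "vec.subspace U"
    unfolding vec.subspace_def U_def by (auto simp only: mem_Collect_eq lin) simp_all
  obtain u where u: "u \<in> ?H" "?l u \<noteq> 0"
  proof -
    consider "n1 \<noteq> 0" | "n2 \<noteq> 0" | "n3 \<noteq> 0" using n by auto
    then show ?thesis
      by cases (use that[of "vec5 0 1 0 0 0"] that[of "vec5 0 0 1 0 0"] that[of "vec5 0 0 0 1 0"] in simp_all)
  qed
  have "vec.dim ?H = vec.dim U + 1"
    unfolding U_def by (rule dim_kernel_functional[OF subspace_infinity lin u])
  then have dim: "vec.dim U = 3" by (simp add: dim_infinity)
  have "Z \<inter> U \<subseteq> vec.span {vec5 0 0 0 0 1}"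
  proof
    fix v assume v: "v \<in> Z \<inter> U"
    then have "v $ 0 = 0" and "?l v = 0" by (auto simp: U_def)
    then have "v $ 1 = 0 \<and> v $ 2 = 0 \<and> v $ 3 = 0" using v Z_infinity curve by blast
    with \<open>v $ 0 = 0\<close> have "v = v $ 4 *s vec5 0 0 0 0 1" by (simp add: vec_eq_iff_5)
    then show "v \<in> vec.span {vec5 0 0 0 0 1}" by (metis vec.span_base vec.span_scale singletonI)
  qed
  then have "vec.dim (Z \<inter> U) \<le> 1"
    using vec.dim_le_card[of "Z \<inter> U" "{vec5 0 0 0 0 1}"] by simp
  with plane_meets_Z[OF U dim] U dim that show ?thesis by simp
qed

text \<open>The points (1, 1, 0), (0, 1, 1) and (1, a, b) of C have determinant 1 + a + b, hence
  form a basis. So \<open>w\<close> differs from a combination of their lifts only in the last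
  coordinate; if the difference is nonzero, the vertex itself lies in \<open>U\<close>.\<close>

lemma span_infinity_part:
  assumes U: "vec.subspace U" and a: "b ^ (\<sigma> + 2) = 1 + a ^ (\<sigma> + 2)" "1 + a + b \<noteq> 0"
    and s: "vec5 0 1 1 0 x1 \<in> U" "vec5 0 0 1 1 x2 \<in> U" "vec5 0 1 a b x3 \<in> U"
    and w: "w \<in> U" "w $ 0 = 0"
  shows "w \<in> vec.span (Z \<inter> U)"
proof -
  let ?s1 = "vec5 0 1 1 0 x1" and ?s2 = "vec5 0 0 1 1 x2" and ?s3 = "vec5 0 1 a b x3"
  let ?e = "vec5 0 0 0 0 1"
  have Z: "?s1 \<in> Z" "?s2 \<in> Z" "?s3 \<in> Z" "?e \<in> Z"
    using a by (simp_all add: Z_infinity zero_power add.assoc del: add_2_eq_Suc')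
  \<comment> \<open>The sum of the three middle coordinates vanishes on \<open>?s1\<close> and
    \<open>?s2\<close>, which determines the coefficient of \<open>?s3\<close>.\<close>
  define C where "C = (w $ 1 + w $ 2 + w $ 3) / (1 + a + b)"
  define u where "u = (w $ 1 + C) *s ?s1 + (w $ 3 + b * C) *s ?s2 + C *s ?s3"
  have C: "C + a * C + b * C = w $ 1 + w $ 2 + w $ 3"
  proof -
    have "C * (1 + a + b) = w $ 1 + w $ 2 + w $ 3" using a(2) by (simp add: C_def)
    then show ?thesis by (simp add: algebra_simps)
  qed
  have u2: "u $ 2 = w $ 2"
  proof -
    have "u $ 2 = (C + a * C + b * C) + w $ 1 + w $ 3" by (simp add: u_def algebra_simps)
    also have "\<dots> = w $ 2" unfolding C by (simp add: ac_simps)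
    finally show ?thesis .
  qed
  have u: "u \<in> vec.span (Z \<inter> U)"
    unfolding u_def using Z s
    by (intro vec.span_add vec.span_scale vec.span_base) auto
  have "vec.span (Z \<inter> U) \<subseteq> U" using U by (intro vec.span_minimal) auto
  with u w U have wu: "w - u \<in> U" by (auto intro: vec.subspace_diff)
  define d where "d = w $ 4 - u $ 4"
  have d: "w - u = d *s ?e"
    using w u2 by (simp add: vec_eq_iff_5 d_def) (simp add: u_def mult.commute diff_eq_add)
  have "d *s ?e \<in> vec.span (Z \<inter> U)"
  proof (cases "d = 0")
    case False
    have "(1 / d) *s (d *s ?e) \<in> U" using U wu d by (metis vec.subspace_scale)
    then have "?e \<in> U" using False by simp
    then show ?thesis using Z(4) by (intro vec.span_scale vec.span_base) auto
  qed (simp add: vec.span_zero)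
  with u d show ?thesis by (metis diff_add_cancel vec.span_add)
qed

lemma solid_spanned:
  assumes U: "vec.subspace U" and dim: "vec.dim U = 4"
  shows "vec.dim (Z \<inter> U) \<ge> 4"
proof -
  obtain a where a: "a \<in> K" "a ^ \<sigma> + a\<^sup>2 \<noteq> 0" using ex_K .
  \<comment> \<open>\<open>b\<close> exists because x^(\<sigma> + 2) permutes F_q; the choice of
    \<open>a\<close> then rules out b = a + 1.\<close>
  obtain b where b: "b ^ (\<sigma> + 2) = 1 + a ^ (\<sigma> + 2)"
    using power_surj_K[of "1 + a ^ (\<sigma> + 2)"] K_closed[OF a(1) a(1)] K_closed(1)[OF K_01(2)] by metis
  have ab: "1 + a + b \<noteq> 0"
  proof
    assume "1 + a + b = 0"
    then have "b = a + 1" by (metis add_eq_0_iff add.commute)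
    then have "a ^ (\<sigma> + 2) + (a + 1) ^ (\<sigma> + 2) + 1 = 0"
      using b by (simp add: ac_simps del: add_2_eq_Suc')
    with a show False by (simp only: power_sum_eq)
  qed
  let ?e = "vec5 0 0 0 0 1"
  have eZ: "?e \<in> Z" by (simp add: Z_infinity zero_power)
  have "U \<subseteq> vec.span (Z \<inter> U)"
  proof (cases "?e \<in> U")
    case e: True
    have e_span: "?e \<in> vec.span (Z \<inter> U)" using e eZ by (auto intro: vec.span_base)
    \<comment> \<open>With the vertex in \<open>U\<close>, X_4 is free: changing it to g \<epsilon>
      X_0 makes the trace equal to \<open>g\<close>.\<close>
    have affine: "w \<in> vec.span (Z \<inter> U)" if w: "w \<in> U" "w $ 0 \<noteq> 0" for w
    proof -
      define g where "g = Gam e \<epsilon> (w $ 1 / w $ 0) + Gam e \<epsilon> (w $ 2 / w $ 0) + Gam e \<epsilon> (w $ 3 / w $ 0)"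
      define c where "c = g * \<epsilon> * w $ 0 - w $ 4"
      have "g \<in> K" by (simp add: g_def K_closed)
      then have "tr (g * \<epsilon>) = g" by (simp add: tr_mult_K)
      then have "w + c *s ?e \<in> Z"
        using w by (simp add: Z_affine c_def g_def)
      moreover have "w + c *s ?e \<in> U" using U w e by (simp add: vec.subspace_add vec.subspace_scale)
      ultimately have "(w + c *s ?e) - c *s ?e \<in> vec.span (Z \<inter> U)"
        using e_span by (intro vec.span_diff vec.span_scale) (auto intro: vec.span_base)
      then show ?thesis by simp
    qed
    show ?thesis
    proof (cases "\<exists>u\<in>U. u $ 0 \<noteq> 0")
      case True
      then obtain u where u: "u \<in> U" "u $ 0 \<noteq> 0" by blast
      show ?thesis
      proof
        fix w assume w: "w \<in> U"
        show "w \<in> vec.span (Z \<inter> U)"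
        proof (cases "w $ 0 = 0")
          case True
          \<comment> \<open>A vector at infinity is a difference of two affine vectors of
            \<open>U\<close>.\<close>
          have "w + u \<in> vec.span (Z \<inter> U)"
            using U u w True by (intro affine) (auto simp: vec.subspace_add)
          then have "(w + u) - u \<in> vec.span (Z \<inter> U)"
            using affine[OF u] by (rule vec.span_diff)
          then show ?thesis by simp
        qed (use affine w in simp)
      qed
    next
      case False
      then have "U = {v. v $ 0 = 0}"
        using U subspace_infinity dim dim_infinity by (intro vec.subspace_dim_equal) auto
      then show ?thesis
        using span_infinity_part[OF U b ab, of 0 0 0] by auto
    qed
  next
    case False
    \<comment> \<open>Without the vertex, \<open>U\<close> is a graph over the first four
      coordinates.\<close>
    have lift: "\<exists>x4. vec5 x0 x1 x2 x3 x4 \<in> U" for x0 x1 x2 x3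
    proof -
      have "?e \<notin> vec.span U" using False U by (simp add: vec.span_eq_iff[THEN iffD2])
      then have "vec.dim (insert ?e U) = 5" using dim by (simp add: vec.dim_insert)
      then have "vec.span (insert ?e U) = UNIV"
        using vec.dim_eq_full[of "insert ?e U"] by (simp add: vec.dimension_def card_cart_basis)
      then have "vec5 x0 x1 x2 x3 0 \<in> vec.span (insert ?e U)" by simp
      then obtain c where "vec5 x0 x1 x2 x3 0 - c *s ?e \<in> U"
        using U by (auto simp: vec.span_insert vec.span_eq_iff[THEN iffD2])
      moreover have "vec5 x0 x1 x2 x3 0 - c *s ?e = vec5 x0 x1 x2 x3 (- c)"
        by (simp add: vec_eq_iff_5)
      ultimately show ?thesis by metis
    qed
    obtain x1 x2 x3 where s: "vec5 0 1 1 0 x1 \<in> U" "vec5 0 0 1 1 x2 \<in> U" "vec5 0 1 a b x3 \<in> U"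
      using lift by metis
    \<comment> \<open>The affine point is sought with X_1 = X_2 = 0, where two values of
      \<open>Gam\<close> vanish and X_4 = c + m y for X_3 = y.\<close>
    obtain c m where cm: "vec5 1 0 0 0 c \<in> U" "vec5 0 0 0 1 m \<in> U" using lift by metis
    obtain y where y: "tr (c + m * y) = Gam e \<epsilon> y" by (rule Gam_eq_tr_affine)
    define u where "u = vec5 1 0 0 0 c + y *s vec5 0 0 0 1 m"
    have u: "u \<in> U" "u $ 0 = 1"
      using cm U by (simp_all add: u_def vec.subspace_add vec.subspace_scale)
    have "u \<in> Z"
      using y by (subst Z_affine) (simp_all add: u_def mult.commute)
    then have u_span: "u \<in> vec.span (Z \<inter> U)" using u by (auto intro: vec.span_base)
    show ?thesis
    proof
      fix w assume w: "w \<in> U"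
      have "w - w $ 0 *s u \<in> vec.span (Z \<inter> U)"
        using U u w by (intro span_infinity_part[OF U b ab s])
          (auto simp: vec.subspace_diff vec.subspace_scale)
      then have "(w - w $ 0 *s u) + w $ 0 *s u \<in> vec.span (Z \<inter> U)"
        using u_span by (intro vec.span_add vec.span_scale)
      then show "w \<in> vec.span (Z \<inter> U)" by simp
    qed
  qed
  then have "vec.dim U \<le> vec.dim (Z \<inter> U)" by (rule vec.dim_mono)
  with dim show ?thesis by simp
qed

lemma cutting_gaps:
  "cutting_gap 1 (V4 e \<epsilon>) = 2" "cutting_gap 2 (V4 e \<epsilon>) = 2" "cutting_gap 3 (V4 e \<epsilon>) = 0"
proof -
  obtain U1 where U1: "vec.subspace U1" "vec.dim U1 = 2" "Z \<inter> U1 = {0}"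
    using ex_line_disjoint_Z .
  have "vec.dim (Z \<inter> U1) = 0" unfolding U1(3) by simp
  with U1 show "cutting_gap 1 (V4 e \<epsilon>) = 2" using cutting_gap_eqI[of 1 0 U1] by simp
  obtain U2 where "vec.subspace U2" "vec.dim U2 = 3" "vec.dim (Z \<inter> U2) = 1"
    using ex_plane_one_point .
  then show "cutting_gap 2 (V4 e \<epsilon>) = 2" using cutting_gap_eqI[of 2 1 U2] plane_meets_Z by simp
  \<comment> \<open>All solids are spanned by their points, so any solid attains the minimum; the
    hyperplane at infinity is taken.\<close>
  let ?H = "{v :: 'a ^ 5. v $ 0 = 0}"
  have "vec.dim (Z \<inter> ?H) \<le> vec.dim ?H" by (rule vec.dim_subset) simp
  then have "vec.dim (Z \<inter> ?H) = 4"
    using solid_spanned[OF subspace_infinity dim_infinity] dim_infinity by simp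
  then show "cutting_gap 3 (V4 e \<epsilon>) = 0"
    using cutting_gap_eqI[of 3 4 ?H] solid_spanned subspace_infinity dim_infinity by simp
qed

end

theorem proposition4p10:
  fixes e :: nat and \<epsilon> :: "'a::{field,finite}"
  assumes "e \<ge> 3" and "odd e"
    and "CARD('a) = (2 ^ e)\<^sup>2"
    and "admissible e \<epsilon>"
  shows "cutting_gap 1 (V4 e \<epsilon>) = 2 \<and> cutting_gap 2 (V4 e \<epsilon>) = 2 \<and> cutting_gap 3 (V4 e \<epsilon>) = 0"
proof -
  interpret bt_hypersurface e \<epsilon> using assms by unfold_locales
  show ?thesis using cutting_gaps by blast
qed

end
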